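(* Let $n\ge 2$ be an integer, let $L$ be a closed subgroup of $\mathrm{B}(n)$ and let $\Theta$ be a nonempty subset of $\Theta(n)$. Assume that the restriction $\varphi_\Theta|_L:L\to\mathbb{R}^\Theta$ is proper (preimages of compact sets are compact). Then the $L$-action $\rho|_L$ on $\mathbb{R}^{n-1}\cong\mathrm{B}(n)/H$ is proper, where $H:=\{X\in\mathrm{B}(n) : x_{in}=0 \text{ for all } 1\le i<n\}$ and $\rho$ is the $\mathrm{B}(n)$-action on $\mathbb{R}^{n-1}$ given by $$\left(\begin{pmatrix}A&v\\0&\lambda\end{pmatrix},w\right)\mapsto\frac{Aw+v}{\lambda},\qquad A\in\mathrm{B}(n-1),\ v\in\mathbb{R}^{n-1},\ \lambda\in\mathbb{R}^\times .$$
   Context: $[n]:=\{1,\dots,n\}$. $\mathrm{B}(n)$ is the topological group of invertible real upper triangular $n\times n$ matrices. For a real square matrix $X=(x_{ij})$, $\|X\|:=\max_{i,j}|x_{ij}|$. For $1\le i\le j\le n$, $\Phi_{ij}:\mathrm{B}(n)\to\mathrm{B}(j-i+1)$ sends $X=(x_{st})_{1\le s,t\le n}$ to its submatrix $(x_{st})_{i\le s,t\le j}$. For $m\ge1$ and $1\le q\le m$, $\bigwedge^q:\mathrm{GL}(m,\mathbb{R})\to\mathrm{GL}(N,\mathbb{R})$, $N=\binom{m}{q}$, is the $q$-th exterior power representation (compound matrix): rows and columns are indexed by $q$-element subsets $I,J$ of $[m]$ in lexicographic order, and the $(I,J)$-entry of $\bigwedge^qA$ is the minor $\det(A_{IJ})$.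 By convention $\bigwedge^0X:=1\in\mathrm{GL}(1,\mathbb{R})$, so $\|\bigwedge^0X\|=1$. $\Theta(n):=\{(i,q,\varepsilon)\in[n]\times[n]\times\{\pm1\} : q\le n-i\}$. For nonempty $\Theta\subset\Theta(n)$, $\varphi_\Theta:\mathrm{B}(n)\to\mathbb{R}^\Theta$ is $$\varphi_\Theta(X):=\left(\log\frac{\|\bigwedge^q\Phi_{in}(X^\varepsilon)\|}{\max\{\|\bigwedge^q\Phi_{i,n-1}(X^\varepsilon)\|,\ \|\bigwedge^{q-1}\Phi_{i,n-1}(X^\varepsilon)\|\,|x_{nn}^\varepsilon|\}}\right)_{(i,q,\varepsilon)\in\Theta}.$$ The group $H$ is the stabilizer of $0$ under the transitive action $\rho$, which gives the identification $\mathbb{R}^{n-1}\cong\mathrm{B}(n)/H$. A continuous action of a locally compact Hausdorff group $L$ on a locally compact Hausdorff space $S$ is proper if the map $L\times S\to S\times S$, $(g,x)\mapsto(x,gx)$, is such that preimages of compact sets are compact. *)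

theory Defs
  imports
    "HOL-Analysis.Abstract_Topological_Spaces"
    "HOL-Algebra.Group_Action"
    "HOL-Library.List_Lexorder"
    "Jordan_Normal_Form.Determinant"
    "Jordan_Normal_Form.DL_Submatrix"
begin

unbundle no vec_syntax

text \<open>Matrices and vectors are those of \<^theory>\<open>Jordan_Normal_Form.Matrix\<close>, whose entries are
  indexed from 0. The index arguments of \<open>Phi\<close>, \<open>Theta\<close> and \<open>phi\<close> count from 1, so an index
  \<open>i\<close> there refers to row or column \<open>i - 1\<close> of a matrix.\<close>

section \<open>The group of invertible upper triangular matrices\<close>

definition UT :: "nat \<Rightarrow> real mat monoid" where
  "UT n = \<lparr>carrier = {X \<in> carrier_mat n n. upper_triangular X \<and> invertible_mat X},
           monoid.mult = (*), one = 1\<^sub>m n\<rparr>"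

definition mat_topology :: "nat \<Rightarrow> nat \<Rightarrow> real mat topology" where
  "mat_topology nr nc = pullback_topology (carrier_mat nr nc)
     (\<lambda>A. \<lambda>ij\<in>{..<nr} \<times> {..<nc}. A $$ ij) (powertop_real ({..<nr} \<times> {..<nc}))"

definition vec_topology :: "nat \<Rightarrow> real vec topology" where
  "vec_topology m = pullback_topology (carrier_vec m)
     (\<lambda>v. \<lambda>i\<in>{..<m}. v $ i) (powertop_real {..<m})"

definition UT_topology :: "nat \<Rightarrow> real mat topology" where
  "UT_topology n = subtopology (mat_topology n n) (carrier (UT n))"

section \<open>The map \<open>phi\<close>\<close>

definition mat_norm :: "real mat \<Rightarrow> real" where
  "mat_norm A = Max (abs ` elements_mat A)"

definition Phi :: "nat \<Rightarrow> nat \<Rightarrow> real mat \<Rightarrow> real mat" where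
  "Phi i j X = submatrix X {i - 1..<j} {i - 1..<j}"

text \<open>The \<open>q\<close>-element subsets of \<open>{..<m}\<close>, in the lexicographic order of their increasing
  enumerations.\<close>

definition lex_subsets :: "nat \<Rightarrow> nat \<Rightarrow> nat set list" where
  "lex_subsets m q = sorted_key_list_of_set sorted_list_of_set {I. I \<subseteq> {..<m} \<and> card I = q}"

text \<open>For \<open>q = 0\<close> this is the \<open>1 \<times> 1\<close> identity matrix, see \<open>exterior_power_0\<close> below.\<close>

definition exterior_power :: "nat \<Rightarrow> real mat \<Rightarrow> real mat" where
  "exterior_power q A = mat (dim_row A choose q) (dim_col A choose q)
     (\<lambda>(a, b). det (submatrix A (lex_subsets (dim_row A) q ! a) (lex_subsets (dim_col A) q ! b)))"

definition Theta :: "nat \<Rightarrow> (nat \<times> nat \<times> int) set" where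
  "Theta n = {(i, q, \<epsilon>). i \<in> {1..n} \<and> q \<in> {1..n} \<and> \<epsilon> \<in> {1, -1} \<and> q \<le> n - i}"

definition phi :: "nat \<Rightarrow> (nat \<times> nat \<times> int) set \<Rightarrow> real mat \<Rightarrow> nat \<times> nat \<times> int \<Rightarrow> real" where
  "phi n \<Theta> X = (\<lambda>(i, q, \<epsilon>)\<in>\<Theta>.
     let Y = X [^]\<^bsub>UT n\<^esub> \<epsilon> in
     ln (mat_norm (exterior_power q (Phi i n Y)) /
         max (mat_norm (exterior_power q (Phi i (n - 1) Y)))
             (mat_norm (exterior_power (q - 1) (Phi i (n - 1) Y)) *
               \<bar>X $$ (n - 1, n - 1) powi \<epsilon>\<bar>)))"

section \<open>Proper maps and proper actions\<close>

text \<open>The library's \<^const>\<open>proper_map\<close> (closed map with compact fibres) is a different notion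
  for general spaces.\<close>

definition compact_preimages :: "'a topology \<Rightarrow> 'b topology \<Rightarrow> ('a \<Rightarrow> 'b) \<Rightarrow> bool" where
  "compact_preimages S T f \<longleftrightarrow>
     (\<forall>K. compactin T K \<longrightarrow> compactin S {x \<in> topspace S. f x \<in> K})"

definition continuous_action ::
    "('g, 'm) monoid_scheme \<Rightarrow> 'g topology \<Rightarrow> 's topology \<Rightarrow> ('g \<Rightarrow> 's \<Rightarrow> 's) \<Rightarrow> bool" where
  "continuous_action G TG S \<alpha> \<longleftrightarrow>
     group_action G (topspace S) \<alpha> \<and> topspace TG = carrier G \<and>
     continuous_map (prod_topology TG S) S (\<lambda>(g, x). \<alpha> g x)"

definition proper_action ::
    "('g, 'm) monoid_scheme \<Rightarrow> 'g topology \<Rightarrow> 's topology \<Rightarrow> ('g \<Rightarrow> 's \<Rightarrow> 's) \<Rightarrow> bool" where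
  "proper_action G TG S \<alpha> \<longleftrightarrow>
     continuous_action G TG S \<alpha> \<and>
     compact_preimages (prod_topology TG S) (prod_topology S S) (\<lambda>(g, x). (x, \<alpha> g x))"

section \<open>The action on \<open>\<real>\<^sup>n\<^sup>-\<^sup>1\<close>\<close>

definition rho :: "nat \<Rightarrow> real mat \<Rightarrow> real vec \<Rightarrow> real vec" where
  "rho n X = (\<lambda>w\<in>carrier_vec (n - 1).
     let (A, V, _, D) = split_block X (n - 1) (n - 1) in
     inverse (D $$ (0, 0)) \<cdot>\<^sub>v (A *\<^sub>v w + col V 0))"

text \<open>The subgroup \<open>H\<close> with \<open>UT n / H \<cong> \<real>\<^sup>n\<^sup>-\<^sup>1\<close>; see \<open>stabilizer_rho\<close>, \<open>quotient_map_rho\<close> and \<open>rho_fibres\<close>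
  below.\<close>

definition stab0 :: "nat \<Rightarrow> real mat set" where
  "stab0 n = {X \<in> carrier (UT n). \<forall>i < n - 1. X $$ (i, n - 1) = 0}"

section \<open>Basic facts\<close>

declare One_nat_def [simp del]

lemma (in linorder) sorted_key_list_of_set_facts:
  assumes "inj_on f A" "finite A"
  shows "set (sorted_key_list_of_set f A) = A"
    and "length (sorted_key_list_of_set f A) = card A"
    and "sorted_wrt (<) (map f (sorted_key_list_of_set f A))"
proof -
  interpret folding_insort_key "(\<le>)" "(<)" A f
    by unfold_locales (rule assms(1))
  show "set (sorted_key_list_of_set f A) = A"
    and "length (sorted_key_list_of_set f A) = card A"
    and "sorted_wrt (<) (map f (sorted_key_list_of_set f A))"
    using assms(2) by simp_all
qed

lemma lex_subsets:
  "set (lex_subsets m q) = {I. I \<subseteq> {..<m} \<and> card I = q}"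
  "length (lex_subsets m q) = m choose q"
  "sorted_wrt (\<lambda>I J. sorted_list_of_set I < sorted_list_of_set J) (lex_subsets m q)"
proof -
  let ?A = "{I. I \<subseteq> {..<m} \<and> card I = q}"
  have inj: "inj_on sorted_list_of_set ?A"
    by (rule inj_onI)
       (metis (mono_tags, lifting) finite_lessThan finite_subset mem_Collect_eq
          set_sorted_list_of_set)
  have fin: "finite ?A" by simp
  show "set (lex_subsets m q) = ?A"
    unfolding lex_subsets_def by (rule sorted_key_list_of_set_facts(1)[OF inj fin])
  show "length (lex_subsets m q) = m choose q"
    unfolding lex_subsets_def sorted_key_list_of_set_facts(2)[OF inj fin]
    using n_subsets[of "{..<m}" q] by simp
  show "sorted_wrt (\<lambda>I J. sorted_list_of_set I < sorted_list_of_set J) (lex_subsets m q)"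
    unfolding lex_subsets_def
    using sorted_key_list_of_set_facts(3)[OF inj fin] by (simp add: sorted_wrt_map)
qed

lemma exterior_power_0: "exterior_power 0 A = 1\<^sub>m 1"
proof -
  have empty: "lex_subsets m 0 ! 0 = {}" for m
    using lex_subsets(1)[of m 0] lex_subsets(2)[of m 0] nth_mem[of 0 "lex_subsets m 0"]
    by (auto simp: finite_subset)
  show ?thesis
    by (intro eq_matI) (auto simp: exterior_power_def submatrix_def empty)
qed

subsection \<open>The topologies\<close>

lemma topspace_mat_topology [simp]: "topspace (mat_topology nr nc) = carrier_mat nr nc"
  by (auto simp: mat_topology_def topspace_pullback_topology)

lemma topspace_vec_topology [simp]: "topspace (vec_topology m) = carrier_vec m"
  by (auto simp: vec_topology_def topspace_pullback_topology)

lemma topspace_UT_topology [simp]: "topspace (UT_topology n) = carrier (UT n)"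
  by (auto simp: UT_topology_def UT_def)

lemma mat_homeo:
  "homeomorphic_maps (mat_topology nr nc) (powertop_real ({..<nr} \<times> {..<nc}))
     (\<lambda>A. \<lambda>ij\<in>{..<nr} \<times> {..<nc}. A $$ ij) (mat nr nc)"
proof -
  let ?f = "\<lambda>A. \<lambda>ij\<in>{..<nr} \<times> {..<nc}. (A::real mat) $$ ij"
  let ?T = "powertop_real ({..<nr} \<times> {..<nc})"
  have fg: "?f (mat nr nc x) = x" if "x \<in> topspace ?T" for x
    using that by (auto simp: fun_eq_iff PiE_def extensional_def)
  have "continuous_map (mat_topology nr nc) ?T (id \<circ> ?f)"
    unfolding mat_topology_def by (rule continuous_map_pullback) simp
  moreover have "continuous_map ?T (mat_topology nr nc) (mat nr nc)"
    unfolding mat_topology_def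
  proof (rule continuous_map_pullback')
    show "continuous_map ?T ?T (?f \<circ> mat nr nc)"
      by (rule continuous_map_eq[OF continuous_map_id]) (simp add: fg)
  qed auto
  ultimately show ?thesis
    unfolding homeomorphic_maps_def using fg by (auto simp: comp_def)
qed

lemma vec_homeo:
  "homeomorphic_maps (vec_topology m) (powertop_real {..<m})
     (\<lambda>v. \<lambda>i\<in>{..<m}. v $ i) (vec m)"
proof -
  let ?f = "\<lambda>v. \<lambda>i\<in>{..<m}. (v::real vec) $ i"
  let ?T = "powertop_real {..<m}"
  have fg: "?f (vec m x) = x" if "x \<in> topspace ?T" for x
    using that by (auto simp: fun_eq_iff PiE_def extensional_def)
  have "continuous_map (vec_topology m) ?T (id \<circ> ?f)"
    unfolding vec_topology_def by (rule continuous_map_pullback) simp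
  moreover have "continuous_map ?T (vec_topology m) (vec m)"
    unfolding vec_topology_def
  proof (rule continuous_map_pullback')
    show "continuous_map ?T ?T (?f \<circ> vec m)"
      by (rule continuous_map_eq[OF continuous_map_id]) (simp add: fg)
  qed auto
  ultimately show ?thesis
    unfolding homeomorphic_maps_def using fg by (auto simp: comp_def)
qed

lemma locally_compact_powertop_real:
  "finite I \<Longrightarrow> locally_compact_space (powertop_real I)"
  by (auto simp: locally_compact_space_product_topology locally_compact_space_euclidean)

lemma lch_mat_topology:
  "locally_compact_space (mat_topology nr nc)" "Hausdorff_space (mat_topology nr nc)"
proof -
  have h: "mat_topology nr nc homeomorphic_space powertop_real ({..<nr} \<times> {..<nc})"
    using mat_homeo homeomorphic_space_def by blast
  show "locally_compact_space (mat_topology nr nc)"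
    using homeomorphic_locally_compact_space[OF h] by (simp add: locally_compact_powertop_real)
  show "Hausdorff_space (mat_topology nr nc)"
    using homeomorphic_Hausdorff_space[OF h] by (simp add: Hausdorff_space_product_topology)
qed

lemma lch_vec_topology:
  "locally_compact_space (vec_topology m)" "Hausdorff_space (vec_topology m)"
proof -
  have h: "vec_topology m homeomorphic_space powertop_real {..<m}"
    using vec_homeo homeomorphic_space_def by blast
  show "locally_compact_space (vec_topology m)"
    using homeomorphic_locally_compact_space[OF h] by (simp add: locally_compact_powertop_real)
  show "Hausdorff_space (vec_topology m)"
    using homeomorphic_Hausdorff_space[OF h] by (simp add: Hausdorff_space_product_topology)
qed

lemma continuous_map_mat_entry:
  assumes "i < nr" "j < nc"
  shows "continuous_map (mat_topology nr nc) euclideanreal (\<lambda>A. A $$ (i, j))"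
proof -
  have "continuous_map (mat_topology nr nc) (powertop_real ({..<nr} \<times> {..<nc}))
      (\<lambda>A. \<lambda>ij\<in>{..<nr} \<times> {..<nc}. A $$ ij)"
    using mat_homeo unfolding homeomorphic_maps_def by blast
  thus ?thesis
    using assms by (auto simp: continuous_map_componentwise)
qed

lemma continuous_map_UT_entry:
  assumes "i < n" "j < n"
  shows "continuous_map (UT_topology n) euclideanreal (\<lambda>A. A $$ (i, j))"
  unfolding UT_topology_def
  by (rule continuous_map_from_subtopology[OF continuous_map_mat_entry[OF assms]])

lemma continuous_map_vec_entry:
  assumes "i < m"
  shows "continuous_map (vec_topology m) euclideanreal (\<lambda>v. v $ i)"
proof -
  have "continuous_map (vec_topology m) (powertop_real {..<m}) (\<lambda>v. \<lambda>i\<in>{..<m}. v $ i)"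
    using vec_homeo unfolding homeomorphic_maps_def by blast
  thus ?thesis
    using assms by (auto simp: continuous_map_componentwise)
qed

lemma continuous_map_into_mat:
  assumes "\<And>x. x \<in> topspace T \<Longrightarrow> f x \<in> carrier_mat nr nc"
    and "\<And>i j. i < nr \<Longrightarrow> j < nc \<Longrightarrow> continuous_map T euclideanreal (\<lambda>x. f x $$ (i, j))"
  shows "continuous_map T (mat_topology nr nc) f"
  unfolding mat_topology_def
  using assms by (intro continuous_map_pullback') (auto simp: continuous_map_componentwise)

lemma continuous_map_into_vec:
  assumes "\<And>x. x \<in> topspace T \<Longrightarrow> f x \<in> carrier_vec m"
    and "\<And>i. i < m \<Longrightarrow> continuous_map T euclideanreal (\<lambda>x. f x $ i)"
  shows "continuous_map T (vec_topology m) f"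
  unfolding vec_topology_def
  using assms by (intro continuous_map_pullback') (auto simp: continuous_map_componentwise)

subsection \<open>The group\<close>

lemma UT_simps [simp]:
  "X \<otimes>\<^bsub>UT n\<^esub> Y = X * Y" "\<one>\<^bsub>UT n\<^esub> = 1\<^sub>m n"
  by (simp_all add: UT_def)

lemma UT_carrier_iff:
  "X \<in> carrier (UT n) \<longleftrightarrow>
     X \<in> carrier_mat n n \<and> (\<forall>i<n. \<forall>j<i. X $$ (i, j) = 0) \<and> (\<forall>i<n. X $$ (i, i) \<noteq> 0)"
proof -
  have "invertible_mat X \<longleftrightarrow> (\<forall>i<n. X $$ (i, i) \<noteq> 0)"
    if X: "X \<in> carrier_mat n n" and ut: "upper_triangular X"
  proof -
    have "invertible_mat X \<longleftrightarrow> det X \<noteq> 0"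
    proof
      assume "invertible_mat X"
      then obtain Y where Y: "X * Y = 1\<^sub>m n" "Y * X = 1\<^sub>m (dim_row Y)"
        using X unfolding invertible_mat_def inverts_mat_def by auto
      have "dim_row Y = n" "dim_col Y = n"
        using Y X by (metis carrier_matD(2) index_mult_mat(3) index_one_mat(3))+
      hence "Y \<in> carrier_mat n n" by auto
      hence "det X * det Y = 1"
        using Y(1) X by (metis det_mult det_one)
      thus "det X \<noteq> 0" by auto
    next
      assume "det X \<noteq> 0"
      hence "X \<in> Units (ring_mat TYPE(real) n ())"
        by (rule det_non_zero_imp_unit[OF X])
      then obtain Y where "Y \<in> carrier_mat n n" "X * Y = 1\<^sub>m n" "Y * X = 1\<^sub>m n"
        by (auto simp: Units_def ring_mat_def)
      thus "invertible_mat X"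
        using X unfolding invertible_mat_def inverts_mat_def by auto
    qed
    also have "det X = (\<Prod>i<n. X $$ (i, i))"
      using det_upper_triangular[OF ut X] X
      by (simp add: diag_mat_def prod.list_conv_set_nth atLeast0LessThan)
    finally show ?thesis by auto
  qed
  thus ?thesis unfolding UT_def by (auto simp: upper_triangular_def)
qed

lemma UT_mult_index:
  assumes "X \<in> carrier (UT n)" "Y \<in> carrier (UT n)" "i < n" "j < n"
  shows "(X * Y) $$ (i, j) = (\<Sum>k<n. X $$ (i, k) * Y $$ (k, j))"
  using assms by (auto simp: UT_def scalar_prod_def atLeast0LessThan)

lemma UT_mult_diag:
  assumes "X \<in> carrier (UT n)" "Y \<in> carrier (UT n)" "i < n"
  shows "(X * Y) $$ (i, i) = X $$ (i, i) * Y $$ (i, i)"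
proof -
  have "(X * Y) $$ (i, i) = (\<Sum>k\<in>{i}. X $$ (i, k) * Y $$ (k, i))"
    unfolding UT_mult_index[OF assms(1,2,3,3)]
  proof (intro sum.mono_neutral_right ballI)
    fix k assume "k \<in> {..<n} - {i}"
    hence "k < n" "k < i \<or> i < k" by auto
    thus "X $$ (i, k) * Y $$ (k, i) = 0" using assms by (auto simp: UT_carrier_iff)
  qed (use assms in auto)
  thus ?thesis by simp
qed

lemma UT_mult_closed:
  assumes "X \<in> carrier (UT n)" "Y \<in> carrier (UT n)"
  shows "X * Y \<in> carrier (UT n)"
  unfolding UT_carrier_iff
proof (intro conjI allI impI)
  show "X * Y \<in> carrier_mat n n" using assms by (auto simp: UT_def)
next
  fix i j assume ij: "i < n" "j < i"
  have "(\<Sum>k<n. X $$ (i, k) * Y $$ (k, j)) = 0"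
  proof (intro sum.neutral ballI)
    fix k assume "k \<in> {..<n}"
    hence "k < n" "k < i \<or> j < k" using ij by auto
    thus "X $$ (i, k) * Y $$ (k, j) = 0" using assms ij by (auto simp: UT_carrier_iff)
  qed
  thus "(X * Y) $$ (i, j) = 0"
    using ij by (simp add: UT_mult_index[OF assms])
next
  fix i assume "i < n"
  thus "(X * Y) $$ (i, i) \<noteq> 0"
    using assms by (subst UT_mult_diag) (auto simp: UT_carrier_iff)
qed

lemma UT_inverse_ex:
  assumes X: "X \<in> carrier (UT n)"
  shows "\<exists>Y\<in>carrier (UT n). Y * X = 1\<^sub>m n"
proof -
  have Xc: "X \<in> carrier_mat n n" using X by (simp add: UT_def)
  obtain Y where Y: "X * Y = 1\<^sub>m n" "Y * X = 1\<^sub>m (dim_row Y)"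
    using X Xc unfolding UT_def invertible_mat_def inverts_mat_def by auto
  have "dim_row Y = n" "dim_col Y = n"
    using Y Xc by (metis carrier_matD(2) index_mult_mat(3) index_one_mat(3))+
  hence Yc: "Y \<in> carrier_mat n n" by auto
  have YX: "Y * X = 1\<^sub>m n" using Y \<open>dim_row Y = n\<close> by simp
  have low: "\<forall>i<n. j < i \<longrightarrow> Y $$ (i, j) = 0" for j
  proof (induction j rule: less_induct)
    case (less j)
    show ?case
    proof (intro allI impI)
      fix i assume ij: "i < n" "j < i"
      have "0 = (Y * X) $$ (i, j)" using ij YX by simp
      also have "\<dots> = (\<Sum>k<n. Y $$ (i, k) * X $$ (k, j))"
        using ij Xc Yc by (auto simp: scalar_prod_def atLeast0LessThan)
      also have "\<dots> = (\<Sum>k\<in>{j}. Y $$ (i, k) * X $$ (k, j))"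
      proof (intro sum.mono_neutral_right ballI)
        fix k assume "k \<in> {..<n} - {j}"
        hence k: "k < n" "k < j \<or> j < k" by auto
        show "Y $$ (i, k) * X $$ (k, j) = 0"
          using k(2)
        proof
          assume "k < j" thus ?thesis using less.IH[of k] ij by auto
        next
          assume "j < k" thus ?thesis using X k by (simp add: UT_carrier_iff)
        qed
      qed (use ij in auto)
      finally show "Y $$ (i, j) = 0"
        using X ij by (auto simp: UT_carrier_iff)
    qed
  qed
  have "invertible_mat Y"
    using Y YX Yc Xc unfolding invertible_mat_def inverts_mat_def by auto
  hence "Y \<in> carrier (UT n)"
    using low Yc by (auto simp: UT_def upper_triangular_def)
  thus ?thesis using YX by blast
qed

lemma group_UT: "group (UT n)"
proof (rule groupI)
  show "\<one>\<^bsub>UT n\<^esub> \<in> carrier (UT n)" by (auto simp: UT_carrier_iff)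
  show "x \<otimes>\<^bsub>UT n\<^esub> y \<otimes>\<^bsub>UT n\<^esub> z = x \<otimes>\<^bsub>UT n\<^esub> (y \<otimes>\<^bsub>UT n\<^esub> z)"
    if "x \<in> carrier (UT n)" "y \<in> carrier (UT n)" "z \<in> carrier (UT n)" for x y z
    using that by (auto simp: UT_def intro: assoc_mult_mat)
  show "\<one>\<^bsub>UT n\<^esub> \<otimes>\<^bsub>UT n\<^esub> x = x" if "x \<in> carrier (UT n)" for x
    using that by (auto simp: UT_carrier_iff)
qed (use UT_mult_closed UT_inverse_ex in auto)

lemma lch_UT_topology:
  "locally_compact_space (UT_topology n)" "Hausdorff_space (UT_topology n)"
proof -
  let ?T = "mat_topology n n"
  let ?C = "{X \<in> carrier_mat n n. \<forall>i<n. \<forall>j<i. X $$ (i, j) = 0}"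
  let ?O = "{X \<in> carrier_mat n n. \<forall>i<n. X $$ (i, i) \<noteq> (0::real)}"
  have C: "closedin ?T ?C"
  proof -
    have "closedin ?T {X \<in> topspace ?T. X $$ (i, j) \<in> {0}}" if "i < n" "j < n" for i j
      by (rule closedin_continuous_map_preimage[OF continuous_map_mat_entry[OF that]]) simp
    hence "closedin ?T (\<Inter> (insert (carrier_mat n n)
        ((\<lambda>(i, j). {X \<in> topspace ?T. X $$ (i, j) \<in> {0}}) ` {(i, j). j < i \<and> i < n})))"
      by (intro closedin_Inter) (auto intro: closedin_topspace[of ?T, simplified])
    also have "\<Inter> (insert (carrier_mat n n)
        ((\<lambda>(i, j). {X \<in> topspace ?T. X $$ (i, j) \<in> {0}}) ` {(i, j). j < i \<and> i < n})) = ?C"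
      by auto
    finally show ?thesis .
  qed
  have O: "openin ?T ?O"
  proof -
    have "openin ?T {X \<in> topspace ?T. X $$ (i, i) \<in> - {0}}" if "i < n" for i
      by (rule openin_continuous_map_preimage[OF continuous_map_mat_entry[OF that that]])
         (simp add: open_Compl)
    hence "openin ?T (\<Inter> (insert (carrier_mat n n)
        ((\<lambda>i. {X \<in> topspace ?T. X $$ (i, i) \<in> - {0}}) ` {..<n})))"
      by (intro openin_Inter) (auto intro: openin_topspace[of ?T, simplified])
    also have "\<Inter> (insert (carrier_mat n n)
        ((\<lambda>i. {X \<in> topspace ?T. X $$ (i, i) \<in> - {0}}) ` {..<n})) = ?O"
      by auto
    finally show ?thesis .
  qed
  have eq: "UT_topology n = subtopology (subtopology ?T ?O) (?C \<inter> ?O)"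
    unfolding UT_topology_def subtopology_subtopology
    by (rule arg_cong[where f = "subtopology ?T"]) (auto simp: UT_carrier_iff)
  have "locally_compact_space (subtopology ?T ?O)"
    using locally_compact_space_open_subset[OF _ lch_mat_topology(1) O] lch_mat_topology(2)
    by blast
  moreover have "closedin (subtopology ?T ?O) (?C \<inter> ?O)"
    using C closedin_subtopology by blast
  ultimately show "locally_compact_space (UT_topology n)"
    unfolding eq by (rule locally_compact_space_closed_subset)
  show "Hausdorff_space (UT_topology n)"
    unfolding UT_topology_def by (simp add: Hausdorff_space_subtopology lch_mat_topology)
qed

subsection \<open>The action\<close>

lemma rho_closed: "w \<in> carrier_vec (n - 1) \<Longrightarrow> rho n X w \<in> carrier_vec (n - 1)"
  by (rule carrier_vecI) (simp add: rho_def split_block_def Let_def)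

lemma dim_rho: "w \<in> carrier_vec (n - 1) \<Longrightarrow> dim_vec (rho n X w) = n - 1"
  using rho_closed carrier_vecD by blast

lemma rho_index:
  assumes "X \<in> carrier_mat n n" "w \<in> carrier_vec (n - 1)" "i < n - 1"
  shows "rho n X w $ i =
    ((\<Sum>k<n - 1. X $$ (i, k) * w $ k) + X $$ (i, n - 1)) / X $$ (n - 1, n - 1)"
  using assms
  by (auto simp: rho_def split_block_def Let_def scalar_prod_def atLeast0LessThan divide_inverse
      mult.commute)

text \<open>In homogeneous coordinates \<open>rho\<close> is multiplication by \<open>X\<close>.\<close>

lemma rho_homogeneous:
  assumes X: "X \<in> carrier (UT n)" and w: "w \<in> carrier_vec (n - 1)" and n: "n \<ge> 1"
  shows "X *\<^sub>v vec n (\<lambda>i. if i < n - 1 then w $ i else 1) =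
    X $$ (n - 1, n - 1) \<cdot>\<^sub>v vec n (\<lambda>i. if i < n - 1 then rho n X w $ i else 1)"
proof (rule eq_vecI)
  have Xc: "X \<in> carrier_mat n n" using X by (simp add: UT_def)
  fix i assume "i < dim_vec (X $$ (n - 1, n - 1) \<cdot>\<^sub>v
    vec n (\<lambda>i. if i < n - 1 then rho n X w $ i else 1))"
  hence i: "i < n" by simp
  have split: "{..<n} = insert (n - 1) {..<n - 1}" using n by auto
  have "(X *\<^sub>v vec n (\<lambda>i. if i < n - 1 then w $ i else 1)) $ i =
      (\<Sum>k<n. X $$ (i, k) * (if k < n - 1 then w $ k else 1))"
    using Xc i by (auto simp: scalar_prod_def atLeast0LessThan)
  also have "\<dots> = (\<Sum>k<n - 1. X $$ (i, k) * w $ k) + X $$ (i, n - 1)"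
    unfolding split by simp
  also have "\<dots> = X $$ (n - 1, n - 1) * (if i < n - 1 then rho n X w $ i else 1)"
  proof (cases "i < n - 1")
    case True
    thus ?thesis using X n by (simp add: rho_index[OF Xc w] UT_carrier_iff)
  next
    case False
    hence "i = n - 1" using i by simp
    moreover have "(\<Sum>k<n - 1. X $$ (n - 1, k) * w $ k) = 0"
      using X n by (intro sum.neutral) (auto simp: UT_carrier_iff)
    ultimately show ?thesis by simp
  qed
  finally show "(X *\<^sub>v vec n (\<lambda>i. if i < n - 1 then w $ i else 1)) $ i =
    (X $$ (n - 1, n - 1) \<cdot>\<^sub>v vec n (\<lambda>i. if i < n - 1 then rho n X w $ i else 1)) $ i"
    using i by simp
qed (use X in \<open>auto simp: UT_def\<close>)

lemma rho_mult:
  assumes X: "X \<in> carrier (UT n)" and Y: "Y \<in> carrier (UT n)"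
    and w: "w \<in> carrier_vec (n - 1)" and n: "n \<ge> 1"
  shows "rho n (X * Y) w = rho n X (rho n Y w)"
proof (rule eq_vecI)
  let ?e = "\<lambda>w. vec n (\<lambda>i. if i < n - 1 then w $ i else (1::real))"
  let ?l = "\<lambda>X. X $$ (n - 1, n - 1) :: real"
  have c: "X \<in> carrier_mat n n" "Y \<in> carrier_mat n n" "?e v \<in> carrier_vec n" for v
    using X Y by (auto simp: UT_def)
  have l: "?l (X * Y) = ?l X * ?l Y" "?l X \<noteq> 0" "?l Y \<noteq> 0"
    using UT_mult_diag[OF X Y] X Y n by (auto simp: UT_carrier_iff)
  have "?l (X * Y) \<cdot>\<^sub>v ?e (rho n (X * Y) w) = (X * Y) *\<^sub>v ?e w"
    using rho_homogeneous[OF UT_mult_closed[OF X Y] w n] by simp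
  also have "\<dots> = X *\<^sub>v (Y *\<^sub>v ?e w)"
    using c by (intro assoc_mult_mat_vec)
  also have "\<dots> = X *\<^sub>v (?l Y \<cdot>\<^sub>v ?e (rho n Y w))"
    using rho_homogeneous[OF Y w n] by simp
  also have "\<dots> = ?l Y \<cdot>\<^sub>v (X *\<^sub>v ?e (rho n Y w))"
    using c by (intro mult_mat_vec)
  also have "\<dots> = ?l Y \<cdot>\<^sub>v (?l X \<cdot>\<^sub>v ?e (rho n X (rho n Y w)))"
    using rho_homogeneous[OF X rho_closed[OF w] n] by simp
  finally have eq: "?l (X * Y) \<cdot>\<^sub>v ?e (rho n (X * Y) w) =
    ?l Y \<cdot>\<^sub>v (?l X \<cdot>\<^sub>v ?e (rho n X (rho n Y w)))" .
  fix i assume "i < dim_vec (rho n X (rho n Y w))"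
  hence i: "i < n - 1" using rho_closed[OF rho_closed[OF w]] by (metis carrier_vecD)
  show "rho n (X * Y) w $ i = rho n X (rho n Y w) $ i"
    using arg_cong[OF eq, of "\<lambda>v. v $ i"] i l less_le_trans[OF i, of n] by simp
qed (simp add: dim_rho rho_closed w)

lemma rho_one: "w \<in> carrier_vec (n - 1) \<Longrightarrow> rho n (1\<^sub>m n) w = w"
proof (rule eq_vecI)
  assume w: "w \<in> carrier_vec (n - 1)"
  fix i assume "i < dim_vec w"
  hence i: "i < n - 1" using w by auto
  have "(\<Sum>k<n - 1. 1\<^sub>m n $$ (i, k) * w $ k) = (\<Sum>k<n - 1. if k = i then w $ k else 0)"
    using i by (intro sum.cong) auto
  thus "rho n (1\<^sub>m n) w $ i = w $ i"
    using i w by (simp add: rho_index[OF _ w])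
qed (simp add: dim_rho)

lemma group_action_rho:
  assumes n: "n \<ge> 1"
  shows "group_action (UT n) (carrier_vec (n - 1)) (rho n)"
proof -
  interpret group "UT n" by (rule group_UT)
  let ?E = "carrier_vec (n - 1) :: real vec set"
  have bij: "rho n X \<in> Bij ?E" if X: "X \<in> carrier (UT n)" for X
  proof -
    have "bij_betw (rho n X) ?E ?E"
    proof (rule bij_betw_byWitness[where f' = "rho n (inv\<^bsub>UT n\<^esub> X)"])
      show "\<forall>w\<in>?E. rho n (inv\<^bsub>UT n\<^esub> X) (rho n X w) = w"
        using rho_mult[of "inv\<^bsub>UT n\<^esub> X" n X] X n l_inv[OF X] by (auto simp: rho_one)
      show "\<forall>w\<in>?E. rho n X (rho n (inv\<^bsub>UT n\<^esub> X) w) = w"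
        using rho_mult[of X n "inv\<^bsub>UT n\<^esub> X"] X n r_inv[OF X] by (auto simp: rho_one)
    qed (auto intro: rho_closed)
    thus ?thesis by (auto simp: Bij_def rho_def)
  qed
  have "rho n \<in> hom (UT n) (BijGroup ?E)"
  proof (rule homI)
    fix X Y assume XY: "X \<in> carrier (UT n)" "Y \<in> carrier (UT n)"
    have "rho n (X * Y) w = compose ?E (rho n X) (rho n Y) w" for w
      using rho_mult[OF XY _ n] by (cases "w \<in> ?E") (auto simp: compose_def rho_def)
    thus "rho n (X \<otimes>\<^bsub>UT n\<^esub> Y) = rho n X \<otimes>\<^bsub>BijGroup ?E\<^esub> rho n Y"
      using bij XY by (auto simp: BijGroup_def)
  qed (use bij in \<open>auto simp: BijGroup_def\<close>)
  thus ?thesis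
    by (intro group_action.intro group_hom.intro group_hom_axioms.intro group_UT group_BijGroup)
qed

lemma continuous_map_rho:
  assumes n: "n \<ge> 1"
  shows "continuous_map (prod_topology (UT_topology n) (vec_topology (n - 1)))
    (vec_topology (n - 1)) (\<lambda>(X, w). rho n X w)"
proof (rule continuous_map_into_vec)
  let ?T = "prod_topology (UT_topology n) (vec_topology (n - 1))"
  show "(\<lambda>(X, w). rho n X w) p \<in> carrier_vec (n - 1)" if "p \<in> topspace ?T" for p
    using that rho_closed by auto
  fix i assume i: "i < n - 1"
  have X: "continuous_map ?T euclideanreal (\<lambda>p. fst p $$ (a, b))" if "a < n" "b < n" for a b
    using continuous_map_compose[OF continuous_map_fst continuous_map_UT_entry[OF that]]
    by (simp add: comp_def)
  have w: "continuous_map ?T euclideanreal (\<lambda>p. snd p $ k)" if "k < n - 1" for k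
    using continuous_map_compose[OF continuous_map_snd continuous_map_vec_entry[OF that]]
    by (simp add: comp_def)
  have "continuous_map ?T euclideanreal
      (\<lambda>p. ((\<Sum>k<n - 1. fst p $$ (i, k) * snd p $ k) + fst p $$ (i, n - 1)) /
        fst p $$ (n - 1, n - 1))"
    using i n
    by (intro continuous_map_real_divide continuous_map_add continuous_map_sum
        continuous_map_real_mult X w) (auto simp: UT_carrier_iff)
  thus "continuous_map ?T euclideanreal (\<lambda>p. (\<lambda>(X, w). rho n X w) p $ i)"
    by (rule continuous_map_eq) (auto simp: rho_index i UT_def)
qed

lemma continuous_action_rho:
  "n \<ge> 1 \<Longrightarrow> continuous_action (UT n) (UT_topology n) (vec_topology (n - 1)) (rho n)"
  by (simp add: continuous_action_def group_action_rho continuous_map_rho)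

subsection \<open>The identification of \<open>\<real>\<^sup>n\<^sup>-\<^sup>1\<close> with the space of left cosets of \<open>stab0 n\<close>\<close>

lemma rho_zero:
  assumes "X \<in> carrier (UT n)"
  shows "rho n X (0\<^sub>v (n - 1)) = vec (n - 1) (\<lambda>i. X $$ (i, n - 1) / X $$ (n - 1, n - 1))"
proof (rule eq_vecI)
  fix i assume "i < dim_vec (vec (n - 1) (\<lambda>i. X $$ (i, n - 1) / X $$ (n - 1, n - 1)))"
  thus "rho n X (0\<^sub>v (n - 1)) $ i = vec (n - 1) (\<lambda>i. X $$ (i, n - 1) / X $$ (n - 1, n - 1)) $ i"
    using assms by (subst rho_index) (auto simp: UT_def)
qed (simp add: dim_rho)

lemma stabilizer_rho:
  assumes n: "n \<ge> 1"
  shows "stabilizer (UT n) (rho n) (0\<^sub>v (n - 1)) = stab0 n"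
proof -
  have "rho n X (0\<^sub>v (n - 1)) = 0\<^sub>v (n - 1) \<longleftrightarrow> (\<forall>i<n - 1. X $$ (i, n - 1) = 0)"
    if X: "X \<in> carrier (UT n)" for X
  proof -
    have "X $$ (n - 1, n - 1) \<noteq> 0" using X n by (auto simp: UT_carrier_iff)
    thus ?thesis unfolding rho_zero[OF X] by (auto simp: Matrix.vec_eq_iff)
  qed
  thus ?thesis unfolding stabilizer_def stab0_def by auto
qed

lemma rho_section:
  assumes n: "n \<ge> 1"
  defines "s \<equiv> \<lambda>w. mat n n (\<lambda>(i, j). if i = j then 1 else if j = n - 1 then w $ i else (0::real))"
  shows "continuous_map (vec_topology (n - 1)) (UT_topology n) s"
    and "\<And>w. w \<in> carrier_vec (n - 1) \<Longrightarrow> rho n (s w) (0\<^sub>v (n - 1)) = w"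
proof -
  have s: "s w \<in> carrier (UT n)" for w
    by (auto simp: UT_carrier_iff s_def)
  have "continuous_map (vec_topology (n - 1)) (mat_topology n n) s"
  proof (rule continuous_map_into_mat)
    fix i j assume ij: "i < n" "j < n"
    have "i = j \<or> j \<noteq> n - 1 \<or> i < n - 1" using ij by auto
    thus "continuous_map (vec_topology (n - 1)) euclideanreal (\<lambda>w. s w $$ (i, j))"
      using ij continuous_map_vec_entry[of i "n - 1"]
      by (cases "i = j"; cases "j = n - 1") (auto simp: s_def)
  qed (auto simp: s_def)
  thus "continuous_map (vec_topology (n - 1)) (UT_topology n) s"
    unfolding UT_topology_def using s by (auto simp: continuous_map_in_subtopology)
  show "rho n (s w) (0\<^sub>v (n - 1)) = w" if "w \<in> carrier_vec (n - 1)" for w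
    using that n by (subst rho_zero[OF s]) (auto simp: s_def)
qed

lemma quotient_map_rho:
  assumes n: "n \<ge> 1"
  shows "quotient_map (UT_topology n) (vec_topology (n - 1)) (\<lambda>X. rho n X (0\<^sub>v (n - 1)))"
proof -
  have "continuous_map (UT_topology n) (prod_topology (UT_topology n) (vec_topology (n - 1)))
      (\<lambda>X. (X, 0\<^sub>v (n - 1)))"
    by (simp add: continuous_map_pairedI)
  from continuous_map_compose[OF this continuous_map_rho[OF n]]
  have "continuous_map (UT_topology n) (vec_topology (n - 1)) (\<lambda>X. rho n X (0\<^sub>v (n - 1)))"
    by (simp add: comp_def)
  thus ?thesis
    using rho_section[OF n] by (intro retraction_imp_quotient_map)
      (auto simp: retraction_map_def retraction_maps_def)
qed

lemma transitive_action_rho: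
  assumes n: "n \<ge> 1"
  shows "transitive_action (UT n) (carrier_vec (n - 1)) (rho n)"
proof -
  interpret group_action "UT n" "carrier_vec (n - 1)" "rho n" by (rule group_action_rho[OF n])
  interpret group "UT n" by (rule group_UT)
  let ?o = "0\<^sub>v (n - 1) :: real vec"
  have reach: "\<exists>X\<in>carrier (UT n). rho n X ?o = w" if w: "w \<in> carrier_vec (n - 1)" for w
    using rho_section[OF n] w unfolding continuous_map_def by fastforce
  show ?thesis
  proof unfold_locales
    fix v w :: "real vec" assume vw: "v \<in> carrier_vec (n - 1)" "w \<in> carrier_vec (n - 1)"
    obtain X Y where X: "X \<in> carrier (UT n)" "rho n X ?o = v"
      and Y: "Y \<in> carrier (UT n)" "rho n Y ?o = w"
      using reach vw by blast
    have "rho n (inv\<^bsub>UT n\<^esub> X) v = ?o"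
      using X by (metis orbit_sym_aux zero_carrier_vec)
    hence "rho n (Y \<otimes>\<^bsub>UT n\<^esub> inv\<^bsub>UT n\<^esub> X) v = w"
      using composition_rule[OF vw(1) Y(1) inv_closed[OF X(1)]] Y(2) by metis
    moreover have "Y \<otimes>\<^bsub>UT n\<^esub> inv\<^bsub>UT n\<^esub> X \<in> carrier (UT n)"
      by (rule m_closed[OF Y(1) inv_closed[OF X(1)]])
    ultimately show "\<exists>g\<in>carrier (UT n). rho n g v = w"
      by blast
  qed
qed

lemma rho_fibres:
  assumes n: "n \<ge> 1" and X: "X \<in> carrier (UT n)" and Y: "Y \<in> carrier (UT n)"
  shows "rho n X (0\<^sub>v (n - 1)) = rho n Y (0\<^sub>v (n - 1)) \<longleftrightarrow>
    X <#\<^bsub>UT n\<^esub> stab0 n = Y <#\<^bsub>UT n\<^esub> stab0 n"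
proof -
  interpret group_action "UT n" "carrier_vec (n - 1)" "rho n" by (rule group_action_rho[OF n])
  interpret group "UT n" by (rule group_UT)
  let ?o = "0\<^sub>v (n - 1) :: real vec"
  have sub: "subgroup (stab0 n) (UT n)"
    using stabilizer_subgroup[of ?o] stabilizer_rho[OF n] by simp
  have "rho n X ?o = rho n Y ?o \<longleftrightarrow> rho n (inv\<^bsub>UT n\<^esub> X) (rho n Y ?o) = ?o"
  proof
    assume "rho n X ?o = rho n Y ?o"
    thus "rho n (inv\<^bsub>UT n\<^esub> X) (rho n Y ?o) = ?o"
      using orbit_sym_aux[OF X, of ?o "rho n Y ?o"] by simp
  next
    assume *: "rho n (inv\<^bsub>UT n\<^esub> X) (rho n Y ?o) = ?o"
    have "rho n Y ?o \<in> carrier_vec (n - 1)" by (rule rho_closed) simp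
    from orbit_sym_aux[OF inv_closed[OF X] this *]
    show "rho n X ?o = rho n Y ?o" using inv_inv[OF X] by simp
  qed
  also have "\<dots> \<longleftrightarrow> inv\<^bsub>UT n\<^esub> X \<otimes>\<^bsub>UT n\<^esub> Y \<in> stab0 n"
    using composition_rule[OF zero_carrier_vec inv_closed[OF X] Y] m_closed[OF inv_closed[OF X] Y]
    unfolding stabilizer_rho[OF n, symmetric] stabilizer_def by (simp del: UT_simps)
  also have "\<dots> \<longleftrightarrow> X <#\<^bsub>UT n\<^esub> stab0 n = Y <#\<^bsub>UT n\<^esub> stab0 n"
  proof
    assume *: "inv\<^bsub>UT n\<^esub> X \<otimes>\<^bsub>UT n\<^esub> Y \<in> stab0 n"
    have "Y = X \<otimes>\<^bsub>UT n\<^esub> (inv\<^bsub>UT n\<^esub> X \<otimes>\<^bsub>UT n\<^esub> Y)"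
      using X Y by (simp del: UT_simps add: m_assoc[symmetric])
    hence "Y \<in> X <#\<^bsub>UT n\<^esub> stab0 n"
      using * unfolding l_coset_def by blast
    thus "X <#\<^bsub>UT n\<^esub> stab0 n = Y <#\<^bsub>UT n\<^esub> stab0 n"
      using l_repr_independence[OF _ X sub] by blast
  next
    assume "X <#\<^bsub>UT n\<^esub> stab0 n = Y <#\<^bsub>UT n\<^esub> stab0 n"
    moreover have "Y \<in> Y <#\<^bsub>UT n\<^esub> stab0 n"
      using subgroup.one_closed[OF sub] r_one[OF Y, symmetric] unfolding l_coset_def by blast
    ultimately obtain h where h: "h \<in> stab0 n" "Y = X \<otimes>\<^bsub>UT n\<^esub> h"
      unfolding l_coset_def by blast
    have "inv\<^bsub>UT n\<^esub> X \<otimes>\<^bsub>UT n\<^esub> Y = h"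
      using h X subgroup.mem_carrier[OF sub h(1)]
      by (simp del: UT_simps add: m_assoc[symmetric])
    thus "inv\<^bsub>UT n\<^esub> X \<otimes>\<^bsub>UT n\<^esub> Y \<in> stab0 n" using h by simp
  qed
  finally show ?thesis .
qed

declare One_nat_def [simp]

end

theory Submission
  imports Defs
begin

text \<open>If \<open>X\<close> moves a point \<open>w\<close> to \<open>w'\<close>, then its last column is determined by the other columns:
  \<open>X\<close> is the block diagonal matrix of \<open>A\<close> and \<open>\<lambda>\<close>, multiplied by the translation by \<open>w'\<close> from the left
  and by the translation by \<open>- w\<close> from the right. For the block diagonal matrix, numerator and
  denominator in \<open>phi\<close> agree; if \<open>w\<close> and \<open>w'\<close> range over compact sets, the two translations change
  the minors only by a bounded factor. So \<open>phi\<close> is bounded on the set of all \<open>X\<close> that move some point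
  of a compact set into a compact set, and by the properness of \<open>phi\<close> on \<open>L\<close> the part of this set
  in \<open>L\<close> lies in a compact set. The inverse of \<open>X\<close> moves \<open>w'\<close> to \<open>w\<close>, which covers \<open>\<epsilon> = - 1\<close>.\<close>

section \<open>Minors\<close>

text \<open>Rows and columns are picked by functions rather than by sets, so that deleting an index
  is a composition, exchanging one is a function update, and repeated indices are allowed (the minor
  is then 0).\<close>

definition minor :: "nat \<Rightarrow> (nat \<Rightarrow> nat) \<Rightarrow> (nat \<Rightarrow> nat) \<Rightarrow> 'a::comm_ring_1 mat \<Rightarrow> 'a" where
  "minor q f g A = det (mat q q (\<lambda>(i, j). A $$ (f i, g j)))"

lemma minor_cong:
  assumes "\<And>i j. i < q \<Longrightarrow> j < q \<Longrightarrow> A $$ (f i, g j) = B $$ (f' i, g' j)"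
  shows "minor q f g A = minor q f' g' B"
  unfolding minor_def using assms by (intro arg_cong[where f = det] eq_matI) auto

lemma minor_transpose:
  assumes "A \<in> carrier_mat r c" "f ` {..<q} \<subseteq> {..<r}" "g ` {..<q} \<subseteq> {..<c}"
  shows "minor q g f (transpose_mat A) = minor q f g A"
proof -
  have "mat q q (\<lambda>(i, j). transpose_mat A $$ (g i, f j)) =
      transpose_mat (mat q q (\<lambda>(i, j). A $$ (f i, g j)))"
    using assms by (intro eq_matI) (auto simp: image_subset_iff)
  thus ?thesis by (simp add: minor_def det_transpose[of _ q])
qed

lemma minor_not_inj:
  assumes "\<not> inj_on f {..<q}"
  shows "minor q f g A = 0"
proof -
  obtain a b where "a < q" "b < q" "a \<noteq> b" "f a = f b"
    using assms by (auto simp: inj_on_def)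
  thus ?thesis
    unfolding minor_def by (intro det_identical_rows[of _ q a b]) auto
qed

text \<open>Two injective enumerations of the same set differ by a permutation of the positions,
  which multiplies the determinant by a sign.\<close>

lemma abs_minor_reindex_rows:
  fixes A :: "'a::linordered_idom mat"
  assumes "inj_on f {..<q}" "inj_on f' {..<q}" "f ` {..<q} = f' ` {..<q}"
  shows "\<bar>minor q f g A\<bar> = \<bar>minor q f' g A\<bar>"
proof -
  \<comment> \<open>\<open>p i\<close> is the position at which \<open>f'\<close> takes the value
    \<open>f i\<close>; the identity beyond \<open>q\<close> is what \<open>permutes\<close>
    demands.\<close>
  define p where "p i = (if i < q then inv_into {..<q} f' (f i) else i)" for i
  have fp: "f' (p i) = f i" and p_less: "p i < q" if "i < q" for i
  proof -
    have "f i \<in> f' ` {..<q}" using assms(3) that by blast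
    thus "f' (p i) = f i" "p i < q"
      using that f_inv_into_f[of "f i" f' "{..<q}"] inv_into_into[of "f i" f' "{..<q}"]
      by (auto simp: p_def)
  qed
  have "inj_on p {0..<q}"
  proof (rule inj_onI)
    fix a b assume "a \<in> {0..<q}" "b \<in> {0..<q}" "p a = p b"
    thus "a = b" using fp[of a] fp[of b] assms(1) by (auto simp: inj_on_def)
  qed
  moreover have "p ` {0..<q} \<subseteq> {0..<q}" using p_less by auto
  ultimately have "bij_betw p {0..<q} {0..<q}"
    by (simp add: bij_betw_def endo_inj_surj)
  hence p: "p permutes {0..<q}"
    by (rule bij_imp_permutes) (simp add: p_def)
  let ?B = "mat q q (\<lambda>(i, j). A $$ (f' i, g j))"
  have "mat q q (\<lambda>(i, j). A $$ (f i, g j)) = mat q q (\<lambda>(i, j). ?B $$ (p i, j))"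
    using fp p_less by (intro eq_matI) auto
  hence "minor q f g A = signof p * minor q f' g A"
    unfolding minor_def using det_permute_rows[of ?B q p] p by simp
  thus ?thesis by (simp add: abs_mult sign_def)
qed

lemma abs_minor_reindex:
  fixes A :: "'a::linordered_idom mat"
  assumes A: "A \<in> carrier_mat r c"
    and f: "inj_on f {..<q}" "inj_on f' {..<q}" "f ` {..<q} = f' ` {..<q}" "f ` {..<q} \<subseteq> {..<r}"
    and g: "inj_on g {..<q}" "inj_on g' {..<q}" "g ` {..<q} = g' ` {..<q}" "g ` {..<q} \<subseteq> {..<c}"
  shows "\<bar>minor q f g A\<bar> = \<bar>minor q f' g' A\<bar>"
proof -
  have "\<bar>minor q f g A\<bar> = \<bar>minor q f' g A\<bar>"
    by (rule abs_minor_reindex_rows[OF f(1-3)])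
  also have "\<dots> = \<bar>minor q g f' (transpose_mat A)\<bar>"
    using A f g by (simp add: minor_transpose)
  also have "\<dots> = \<bar>minor q g' f' (transpose_mat A)\<bar>"
    by (rule abs_minor_reindex_rows[OF g(1-3)])
  also have "\<dots> = \<bar>minor q f' g' A\<bar>"
    using A f g by (simp add: minor_transpose)
  finally show ?thesis .
qed

text \<open>Links the set-indexed \<open>submatrix\<close> with the function-indexed
  \<open>minor\<close>.\<close>

lemma pick_subset:
  assumes "finite I" "card I = q"
  shows "inj_on (pick I) {..<q}" "pick I ` {..<q} = I"
proof -
  show inj: "inj_on (pick I) {..<q}"
  proof (rule strict_mono_on_imp_inj_on)
    show "strict_mono_on {..<q} (pick I)"
      using assms pick_mono_le[of _ I] by (intro strict_mono_onI) auto
  qed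
  show "pick I ` {..<q} = I"
  proof (rule card_subset_eq)
    show "pick I ` {..<q} \<subseteq> I" using assms pick_in_set_le[of _ I] by blast
  qed (use assms in \<open>simp_all add: card_image[OF inj]\<close>)
qed

lemma det_submatrix_minor:
  assumes "A \<in> carrier_mat r c" "I \<subseteq> {..<r}" "card I = q" "J \<subseteq> {..<c}" "card J = q"
  shows "det (submatrix A I J) = minor q (pick I) (pick J) A"
proof -
  have "{i. i < dim_row A \<and> i \<in> I} = I" "{j. j < dim_col A \<and> j \<in> J} = J"
    using assms by auto
  thus ?thesis using assms by (simp add: minor_def submatrix_def)
qed

section \<open>The norm of the exterior powers\<close>

lemma finite_elements_mat: "finite (elements_mat A)"
  by (simp add: elements_mat_def)

text \<open>The norm depends only on the set of entries, so the lexicographic order drops out from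
  here on.\<close>

lemma elements_exterior_power:
  assumes A: "A \<in> carrier_mat r c"
  shows "elements_mat (exterior_power q A) =
    {det (submatrix A I J) | I J. I \<subseteq> {..<r} \<and> card I = q \<and> J \<subseteq> {..<c} \<and> card J = q}"
    (is "_ = ?R")
proof (intro equalityI subsetI)
  fix x assume "x \<in> elements_mat (exterior_power q A)"
  then obtain a b where ab: "a < r choose q" "b < c choose q"
    "x = det (submatrix A (lex_subsets r q ! a) (lex_subsets c q ! b))"
    using A by (auto dest!: elements_matD simp: exterior_power_def)
  have "lex_subsets r q ! a \<in> set (lex_subsets r q)" "lex_subsets c q ! b \<in> set (lex_subsets c q)"
    using ab by (auto simp: lex_subsets(2))
  thus "x \<in> ?R" using ab(3) unfolding lex_subsets(1) by blast
next
  fix x assume "x \<in> ?R"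
  then obtain I J where x: "x = det (submatrix A I J)"
    and "I \<in> set (lex_subsets r q)" "J \<in> set (lex_subsets c q)"
    unfolding lex_subsets(1) by blast
  then obtain a b where "a < r choose q" "I = lex_subsets r q ! a"
    "b < c choose q" "J = lex_subsets c q ! b"
    by (auto simp: in_set_conv_nth lex_subsets(2))
  thus "x \<in> elements_mat (exterior_power q A)"
    using A x by (intro elements_matI[of _ "r choose q" "c choose q" a b])
      (auto simp: exterior_power_def)
qed

text \<open>By reindexing, only the images of \<open>f\<close> and \<open>g\<close> matter if both
  are injective; otherwise the minor vanishes. The degenerate case is included because exchanging a
  column can repeat an index.\<close>

lemma abs_minor_le:
  assumes A: "A \<in> carrier_mat r c" and q: "q \<le> r" "q \<le> c"
    and f: "f ` {..<q} \<subseteq> {..<r}" and g: "g ` {..<q} \<subseteq> {..<c}"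
  shows "\<bar>minor q f g A\<bar> \<le> mat_norm (exterior_power q A)"
proof -
  have *: "\<bar>minor q f g A\<bar> \<le> mat_norm (exterior_power q A)"
    if f: "inj_on f {..<q}" "f ` {..<q} \<subseteq> {..<r}" and g: "inj_on g {..<q}" "g ` {..<q} \<subseteq> {..<c}"
    for f g
  proof -
    let ?I = "f ` {..<q}" and ?J = "g ` {..<q}"
    have card: "card ?I = q" "card ?J = q" using f g by (simp_all add: card_image)
    have "\<bar>minor q f g A\<bar> = \<bar>minor q (pick ?I) (pick ?J) A\<bar>"
      using pick_subset[OF _ card(1)] pick_subset[OF _ card(2)] f g
      by (intro abs_minor_reindex[OF A]) simp_all
    also have "\<dots> = \<bar>det (submatrix A ?I ?J)\<bar>"
      using det_submatrix_minor[OF A f(2) card(1) g(2) card(2)] by simp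
    also have "\<dots> \<in> abs ` elements_mat (exterior_power q A)"
      unfolding elements_exterior_power[OF A] using f g card by blast
    finally show ?thesis
      unfolding mat_norm_def by (intro Max_ge) (simp_all add: finite_elements_mat)
  qed
  show ?thesis
  proof (cases "inj_on f {..<q} \<and> inj_on g {..<q}")
    case True
    thus ?thesis using * f g by blast
  next
    case False
    hence "minor q f g A = 0"
      using minor_not_inj minor_transpose[OF A f g] by metis
    \<comment> \<open>Some genuine minor exists since \<open>q\<close> is at most \<open>r\<close>
      and \<open>c\<close>; it shows that the norm is nonnegative.\<close>
    moreover have "\<bar>minor q id id A\<bar> \<le> mat_norm (exterior_power q A)"
      using q by (intro *) auto
    ultimately show ?thesis by simp
  qed
qed

lemma mat_norm_exterior_power_nonneg:
  assumes "A \<in> carrier_mat r c" "q \<le> r" "q \<le> c"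
  shows "0 \<le> mat_norm (exterior_power q A)"
  using assms by (intro order_trans[OF abs_ge_zero abs_minor_le[OF assms, of id id]]) auto

text \<open>The converse tool: a bound on the minors with injective indices suffices, as
  \<open>pick\<close> enumerates each subset injectively.\<close>

lemma mat_norm_exterior_power_le:
  assumes A: "A \<in> carrier_mat r c" and q: "q \<le> r" "q \<le> c"
    and le: "\<And>f g. inj_on f {..<q} \<Longrightarrow> f ` {..<q} \<subseteq> {..<r} \<Longrightarrow>
      inj_on g {..<q} \<Longrightarrow> g ` {..<q} \<subseteq> {..<c} \<Longrightarrow> \<bar>minor q f g A\<bar> \<le> b"
  shows "mat_norm (exterior_power q A) \<le> b"
  unfolding mat_norm_def
proof (rule Max.boundedI)
  show "finite (abs ` elements_mat (exterior_power q A))" by (simp add: finite_elements_mat)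
  \<comment> \<open>The leading minor makes the set of entries nonempty, so that \<open>Max\<close>
    is meaningful.\<close>
  have "card {..<q} = q" "{..<q} \<subseteq> {..<r}" "{..<q} \<subseteq> {..<c}" using q by auto
  thus "abs ` elements_mat (exterior_power q A) \<noteq> {}"
    unfolding elements_exterior_power[OF A] by blast
  fix x assume "x \<in> abs ` elements_mat (exterior_power q A)"
  then obtain I J where IJ: "I \<subseteq> {..<r}" "card I = q" "J \<subseteq> {..<c}" "card J = q"
    and x: "x = \<bar>det (submatrix A I J)\<bar>"
    unfolding elements_exterior_power[OF A] by blast
  have fin: "finite I" "finite J" using IJ finite_subset by blast+
  show "x \<le> b"
    unfolding x det_submatrix_minor[OF A IJ]
    using IJ pick_subset[OF fin(1) IJ(2)] pick_subset[OF fin(2) IJ(4)] by (intro le) auto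
qed

section \<open>Bordered matrices\<close>

text \<open>Laplace expansion. Since \<open>insert_index i\<close> skips the value \<open>i\<close>,
  composing with it deletes position \<open>i\<close>, and the cofactors are again minors of
  \<open>A\<close>.\<close>

lemma minor_expand_column:
  assumes "l < q"
  shows "minor q f g A = (\<Sum>i<q. A $$ (f i, g l) *
    ((-1) ^ (i + l) * minor (q - 1) (f \<circ> insert_index i) (g \<circ> insert_index l) A))"
proof -
  let ?B = "mat q q (\<lambda>(i, j). A $$ (f i, g j))"
  have "cofactor ?B i l =
      (-1) ^ (i + l) * minor (q - 1) (f \<circ> insert_index i) (g \<circ> insert_index l) A" if "i < q" for i
  proof -
    have "mat_delete ?B i l =
        mat (q - 1) (q - 1) (\<lambda>(i', j'). A $$ ((f \<circ> insert_index i) i', (g \<circ> insert_index l) j'))"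
      using that assms by (intro eq_matI) (auto simp: mat_delete_def insert_index_def)
    thus ?thesis by (simp add: cofactor_def minor_def)
  qed
  thus ?thesis
    unfolding minor_def[of q] using assms
    by (subst laplace_expansion_column[of _ q l]) auto
qed

lemma minor_expand_row:
  assumes "l < q"
  shows "minor q f g A = (\<Sum>j<q. A $$ (f l, g j) *
    ((-1) ^ (l + j) * minor (q - 1) (f \<circ> insert_index l) (g \<circ> insert_index j) A))"
proof -
  let ?B = "mat q q (\<lambda>(i, j). A $$ (f i, g j))"
  have "cofactor ?B l j =
      (-1) ^ (l + j) * minor (q - 1) (f \<circ> insert_index l) (g \<circ> insert_index j) A" if "j < q" for j
  proof -
    have "mat_delete ?B l j =
        mat (q - 1) (q - 1) (\<lambda>(i', j'). A $$ ((f \<circ> insert_index l) i', (g \<circ> insert_index j) j'))"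
      using that assms by (intro eq_matI) (auto simp: mat_delete_def insert_index_def)
    thus ?thesis by (simp add: cofactor_def minor_def)
  qed
  thus ?thesis
    unfolding minor_def[of q] using assms
    by (subst laplace_expansion_row[of _ q l]) auto
qed

text \<open>The matrix \<open>M\<close> is the product of the unipotent matrix with last column \<open>a\<close>, the block diagonal
  matrix of \<open>C\<close> and \<open>\<mu>\<close>, and the unipotent matrix with last column \<open>- b\<close>.\<close>

locale bordered_mat =
  fixes m :: nat and M C :: "real mat" and \<mu> :: real and a b :: "nat \<Rightarrow> real" and R :: real
  assumes M: "M \<in> carrier_mat (Suc m) (Suc m)" and C: "C \<in> carrier_mat m m"
    and block: "\<And>s t. s < m \<Longrightarrow> t < m \<Longrightarrow> M $$ (s, t) = C $$ (s, t)"
    and last_row: "\<And>t. t < m \<Longrightarrow> M $$ (m, t) = 0"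
    and corner: "M $$ (m, m) = \<mu>"
    and last_column: "\<And>s. s < m \<Longrightarrow> M $$ (s, m) = \<mu> * a s - (\<Sum>k<m. C $$ (s, k) * b k)"
    and a_le: "\<And>s. s < m \<Longrightarrow> \<bar>a s\<bar> \<le> R" and b_le: "\<And>s. s < m \<Longrightarrow> \<bar>b s\<bar> \<le> R"
begin

text \<open>For \<open>q\<close> between 1 and \<open>m\<close> this is the norm of the
  \<open>q\<close>-th exterior power of the block diagonal matrix of \<open>C\<close> and
  \<mu>.\<close>

definition denominator :: "nat \<Rightarrow> real" where
  "denominator q = max (mat_norm (exterior_power q C)) (mat_norm (exterior_power (q - 1) C) * \<bar>\<mu>\<bar>)"

lemma minor_block:
  assumes "f ` {..<q} \<subseteq> {..<m}" "g ` {..<q} \<subseteq> {..<m}"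
  shows "minor q f g M = minor q f g C"
  using assms by (intro minor_cong block) auto

lemma abs_minor_block_le:
  assumes "f ` {..<q} \<subseteq> {..<m}" "g ` {..<q} \<subseteq> {..<m}" "q \<le> m"
  shows "\<bar>minor q f g M\<bar> \<le> mat_norm (exterior_power q C)"
  using abs_minor_le[OF C assms(3,3,1,2)] minor_block[OF assms(1,2)] by simp

text \<open>By injectivity the value \<open>m\<close> is taken only once, so dropping its position
  leaves indices inside the block \<open>C\<close>.\<close>

lemma insert_index_avoids:
  assumes "inj_on f {..<q}" "f ` {..<q} \<subseteq> {..<Suc m}" "l < q" "f l = m"
  shows "(f \<circ> insert_index l) ` {..<q - 1} \<subseteq> {..<m}"
proof -
  have "f j < m" if "j < q" "j \<noteq> l" for j
  proof -
    have "f j \<noteq> f l" using assms(1,3) that by (auto simp: inj_on_def)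
    moreover have "f j < Suc m" using assms(2) that by auto
    ultimately show ?thesis using assms(4) by simp
  qed
  thus ?thesis using assms(3) by (auto simp: insert_index_def)
qed

lemma insert_index_subset:
  assumes "f ` {..<q} \<subseteq> {..<m}" "l < q"
  shows "(f \<circ> insert_index l) ` {..<q - 1} \<subseteq> {..<m}"
  using assms by (auto simp: insert_index_def image_subset_iff)

section \<open>Comparison of the exterior powers of \<open>M\<close> with those of its block
  diagonal part\<close>

context
  fixes q :: nat
  assumes q: "1 \<le> q" "q \<le> m"
begin

lemma norms_nonneg:
  "0 \<le> mat_norm (exterior_power q C)" "0 \<le> mat_norm (exterior_power (q - 1) C)"
  "0 \<le> denominator q" "0 \<le> R"
proof -
  show N: "0 \<le> mat_norm (exterior_power q C)" "0 \<le> mat_norm (exterior_power (q - 1) C)"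
    using q by (auto intro!: mat_norm_exterior_power_nonneg[OF C])
  show "0 \<le> denominator q" using N(1) unfolding denominator_def by linarith
  show "0 \<le> R" using a_le[of 0] q by linarith
qed

text \<open>The only entry of the last row that can be nonzero is \<mu>. The minor is therefore 0
  or, up to sign, \<mu> times a minor of \<open>C\<close> of size \<open>q - 1\<close>.\<close>

lemma abs_minor_last_row_le:
  assumes f: "inj_on f {..<q}" "f ` {..<q} \<subseteq> {..<Suc m}" and l: "l < q" "f l = m"
    and g: "inj_on g {..<q}" "g ` {..<q} \<subseteq> {..<Suc m}"
  shows "\<bar>minor q f g M\<bar> \<le> denominator q"
proof (cases "m \<in> g ` {..<q}")
  case False
  hence "g j < m" if "j < q" for j
    using g(2) that by (metis image_eqI image_subset_iff lessThan_iff less_antisym)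
  hence "minor q f g M = 0"
    unfolding minor_expand_row[OF l(1)] using l last_row by (intro sum.neutral) auto
  thus ?thesis using norms_nonneg by simp
next
  case True
  then obtain j where j: "j < q" "g j = m" by auto
  let ?c = "minor (q - 1) (f \<circ> insert_index l) (g \<circ> insert_index j) M"
  have "minor q f g M = (\<Sum>j'\<in>{j}. M $$ (f l, g j') *
      ((-1) ^ (l + j') * minor (q - 1) (f \<circ> insert_index l) (g \<circ> insert_index j') M))"
    unfolding minor_expand_row[OF l(1)]
  proof (rule sum.mono_neutral_right; (intro ballI)?)
    fix j' assume j': "j' \<in> {..<q} - {j}"
    hence "g j' \<noteq> g j" "g j' < Suc m" using g j by (auto simp: inj_on_def)
    hence "M $$ (f l, g j') = 0" using j(2) l(2) last_row by simp
    thus "M $$ (f l, g j') *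
      ((-1) ^ (l + j') * minor (q - 1) (f \<circ> insert_index l) (g \<circ> insert_index j') M) = 0" by simp
  qed (use j in auto)
  hence "\<bar>minor q f g M\<bar> = \<bar>\<mu>\<bar> * \<bar>?c\<bar>"
    using j(2) l(2) corner by (simp add: abs_mult)
  also have "\<dots> \<le> \<bar>\<mu>\<bar> * mat_norm (exterior_power (q - 1) C)"
    using q insert_index_avoids[OF f l] insert_index_avoids[OF g j]
    by (intro mult_left_mono abs_minor_block_le) auto
  also have "\<dots> \<le> denominator q" by (simp add: denominator_def mult.commute)
  finally show ?thesis .
qed

text \<open>The minor is linear in the last column \<mu>\<open>a - C b\<close>. The part
  \<mu>\<open>a\<close> yields \<open>q\<close> terms with minors of \<open>C\<close> of size
  \<open>q - 1\<close>; the part \<open>C b\<close> is a combination of \<open>m\<close> columns of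
  \<open>C\<close> and yields minors of size \<open>q\<close>.\<close>

lemma abs_minor_last_column_le:
  assumes f: "f ` {..<q} \<subseteq> {..<m}"
    and g: "inj_on g {..<q}" "g ` {..<q} \<subseteq> {..<Suc m}" and l: "l < q" "g l = m"
  shows "\<bar>minor q f g M\<bar> \<le> (2 * real m * R) * denominator q"
proof -
  define c where
    "c i = (-1) ^ (i + l) * minor (q - 1) (f \<circ> insert_index i) (g \<circ> insert_index l) M" for i
  note g' = insert_index_avoids[OF g l]
  have c_le: "\<bar>c i\<bar> \<le> mat_norm (exterior_power (q - 1) C)" if "i < q" for i
    using q abs_minor_block_le[OF insert_index_subset[OF f that] g']
    by (simp add: c_def abs_mult)
  \<comment> \<open>The cofactors \<open>c i\<close> do not involve the column at position
    \<open>l\<close>, so the expansion can be read backwards with column \<open>k\<close> of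
    \<open>C\<close> put there.\<close>
  have replaced: "(\<Sum>i<q. C $$ (f i, k) * c i) = minor q f (g(l := k)) C" for k
  proof -
    have "minor (q - 1) (f \<circ> insert_index i) (g(l := k) \<circ> insert_index l) C =
        minor (q - 1) (f \<circ> insert_index i) (g \<circ> insert_index l) M" if "i < q" for i
      unfolding minor_block[OF insert_index_subset[OF f that] g']
      by (rule minor_cong) (auto simp: insert_index_def)
    thus ?thesis unfolding minor_expand_column[OF l(1)] c_def by simp
  qed
  have replaced_le: "\<bar>minor q f (g(l := k)) C\<bar> \<le> mat_norm (exterior_power q C)" if "k < m" for k
  proof -
    have "(g(l := k)) j < m" if j: "j < q" for j
    proof (cases "j = l")
      case False
      hence "g j \<noteq> g l" "g j < Suc m" using g l j by (auto simp: inj_on_def)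
      thus ?thesis using False l(2) by simp
    qed (use \<open>k < m\<close> in simp)
    hence "g(l := k) ` {..<q} \<subseteq> {..<m}" by blast
    thus ?thesis using f q by (intro abs_minor_le[OF C])
  qed
  have "minor q f g M = (\<Sum>i<q. M $$ (f i, m) * c i)"
    unfolding minor_expand_column[OF l(1)] l(2) c_def ..
  also have "\<dots> = (\<Sum>i<q. \<mu> * a (f i) * c i - (\<Sum>k<m. C $$ (f i, k) * b k * c i))"
    using f by (intro sum.cong refl) (auto simp: last_column left_diff_distrib sum_distrib_right)
  also have "\<dots> = (\<Sum>i<q. \<mu> * a (f i) * c i) - (\<Sum>k<m. \<Sum>i<q. C $$ (f i, k) * b k * c i)"
    by (simp add: sum_subtractf sum.swap[of _ "{..<m}"])
  also have "(\<Sum>k<m. \<Sum>i<q. C $$ (f i, k) * b k * c i) = (\<Sum>k<m. b k * minor q f (g(l := k)) C)"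
    unfolding replaced[symmetric] by (simp add: sum_distrib_left ac_simps)
  finally have "\<bar>minor q f g M\<bar> \<le>
      \<bar>\<Sum>i<q. \<mu> * a (f i) * c i\<bar> + \<bar>\<Sum>k<m. b k * minor q f (g(l := k)) C\<bar>"
    by simp
  also have "\<dots> \<le> (\<Sum>i<q. R * denominator q) + (\<Sum>k<m. R * denominator q)"
  proof (intro add_mono order_trans[OF sum_abs] sum_mono)
    fix i assume i: "i \<in> {..<q}"
    hence "\<bar>a (f i)\<bar> \<le> R" using f by (auto intro: a_le)
    hence "\<bar>\<mu> * a (f i) * c i\<bar> \<le> \<bar>\<mu>\<bar> * R * mat_norm (exterior_power (q - 1) C)"
      unfolding abs_mult using c_le[of i] i norms_nonneg by (intro mult_mono) auto
    also have "\<dots> \<le> R * denominator q"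
      unfolding mult.commute[of "\<bar>\<mu>\<bar>"] mult.assoc using norms_nonneg(4)
      by (intro mult_left_mono) (auto simp: denominator_def mult.commute)
    finally show "\<bar>\<mu> * a (f i) * c i\<bar> \<le> R * denominator q" .
  next
    fix k assume "k \<in> {..<m}"
    hence "\<bar>b k * minor q f (g(l := k)) C\<bar> \<le> R * mat_norm (exterior_power q C)"
      unfolding abs_mult using norms_nonneg by (intro mult_mono b_le replaced_le) auto
    also have "\<dots> \<le> R * denominator q"
      using norms_nonneg(4) by (intro mult_left_mono) (auto simp: denominator_def)
    finally show "\<bar>b k * minor q f (g(l := k)) C\<bar> \<le> R * denominator q" .
  qed
  also have "\<dots> = (real q + real m) * (R * denominator q)" by (simp add: distrib_right)
  \<comment> \<open>Using \<open>q\<close> \<le> \<open>m\<close> makes the constant independent of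
    \<open>q\<close>.\<close>
  also have "\<dots> \<le> (2 * real m) * (R * denominator q)"
    using q norms_nonneg by (intro mult_right_mono) auto
  finally show ?thesis by (simp add: mult.assoc)
qed

text \<open>In the constant, the summand 1 covers minors that use the last row or lie in the block;
  \<open>2 * real m * R\<close> covers those that use the last column but not the last row.\<close>

lemma mat_norm_le_denominator:
  "mat_norm (exterior_power q M) \<le> (1 + 2 * real m * R) * denominator q"
proof (rule mat_norm_exterior_power_le[OF M])
  fix f g
  assume f: "inj_on f {..<q}" "f ` {..<q} \<subseteq> {..<Suc m}"
    and g: "inj_on g {..<q}" "g ` {..<q} \<subseteq> {..<Suc m}"
  have split: "(1 + 2 * real m * R) * denominator q = denominator q + 2 * real m * R * denominator q"
    "0 \<le> 2 * real m * R * denominator q"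
    using norms_nonneg by (simp_all add: distrib_right)
  have avoid: "h ` {..<q} \<subseteq> {..<m}" if "m \<notin> h ` {..<q}" "h ` {..<q} \<subseteq> {..<Suc m}" for h
    using that by (metis image_subset_iff lessThan_iff less_antisym rev_image_eqI)
  show "\<bar>minor q f g M\<bar> \<le> (1 + 2 * real m * R) * denominator q"
  proof (cases "m \<in> f ` {..<q}")
    case True
    then obtain l where "l < q" "f l = m" by auto
    from abs_minor_last_row_le[OF f this g] split show ?thesis by linarith
  next
    case False
    note f' = avoid[OF False f(2)]
    show ?thesis
    proof (cases "m \<in> g ` {..<q}")
      case True
      then obtain l where "l < q" "g l = m" by auto
      from abs_minor_last_column_le[OF f' g this] split norms_nonneg(3) show ?thesis by linarith
    next
      case False
      from abs_minor_block_le[OF f' avoid[OF False g(2)]] q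
      have "\<bar>minor q f g M\<bar> \<le> denominator q" by (simp add: denominator_def)
      with split show ?thesis by linarith
    qed
  qed
qed (use q in auto)

text \<open>Minors of \<open>C\<close> of size \<open>q\<close> are minors of \<open>M\<close>, and
  adjoining row and column \<open>m\<close> to a minor of size \<open>q - 1\<close> multiplies it by
  \<mu>, whatever the last column is.\<close>

lemma denominator_le_mat_norm: "denominator q \<le> mat_norm (exterior_power q M)"
proof -
  have M_le: "\<bar>minor q f g M\<bar> \<le> mat_norm (exterior_power q M)"
    if "f ` {..<q} \<subseteq> {..<Suc m}" "g ` {..<q} \<subseteq> {..<Suc m}" for f g
    using q that by (intro abs_minor_le[OF M]) auto
  have "mat_norm (exterior_power q C) \<le> mat_norm (exterior_power q M)"
  proof (rule mat_norm_exterior_power_le[OF C])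
    fix f g assume "f ` {..<q} \<subseteq> {..<m}" "g ` {..<q} \<subseteq> {..<m}"
    thus "\<bar>minor q f g C\<bar> \<le> mat_norm (exterior_power q M)"
      using M_le[of f g] by (auto simp: minor_block less_Suc_eq image_subset_iff)
  qed (use q in auto)
  moreover have "mat_norm (exterior_power (q - 1) C) * \<bar>\<mu>\<bar> \<le> mat_norm (exterior_power q M)"
  proof (cases "\<mu> = 0")
    case True
    thus ?thesis using q by (simp add: mat_norm_exterior_power_nonneg[OF M])
  next
    case False
    have last: "q - 1 < q" using q by simp
    have "mat_norm (exterior_power (q - 1) C) \<le> mat_norm (exterior_power q M) / \<bar>\<mu>\<bar>"
    proof (rule mat_norm_exterior_power_le[OF C])
      fix f g assume fg: "f ` {..<q - 1} \<subseteq> {..<m}" "g ` {..<q - 1} \<subseteq> {..<m}"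
      \<comment> \<open>The index \<open>m\<close> is adjoined at the last position
        \<open>q - 1\<close>, so deleting that position gives back \<open>f\<close> and
        \<open>g\<close> on the remaining ones.\<close>
      let ?f = "f(q - 1 := m)" and ?g = "g(q - 1 := m)"
      have less: "f i < m" "g i < m" if "i < q" "i \<noteq> q - 1" for i
      proof -
        have "i < q - 1" using that by simp
        thus "f i < m" "g i < m" using fg by auto
      qed
      let ?t = "\<lambda>j. M $$ (?f (q - 1), ?g j) * ((-1) ^ (q - 1 + j) *
          minor (q - 1) (?f \<circ> insert_index (q - 1)) (?g \<circ> insert_index j) M)"
      have "minor q ?f ?g M = (\<Sum>j\<in>{q - 1}. ?t j)"
        unfolding minor_expand_row[OF last]
      proof (rule sum.mono_neutral_right; (intro ballI)?)
        fix j assume "j \<in> {..<q} - {q - 1}"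
        hence "M $$ (?f (q - 1), ?g j) = 0" using less(2)[of j] by (simp add: last_row)
        thus "?t j = 0" by simp
      qed (use last in auto)
      moreover have "minor (q - 1) (?f \<circ> insert_index (q - 1)) (?g \<circ> insert_index (q - 1)) M =
          minor (q - 1) f g C"
        unfolding minor_block[OF fg, symmetric] by (rule minor_cong) (auto simp: insert_index_def)
      ultimately have "\<bar>minor q ?f ?g M\<bar> = \<bar>\<mu>\<bar> * \<bar>minor (q - 1) f g C\<bar>"
        by (simp add: corner abs_mult)
      moreover have "\<bar>minor q ?f ?g M\<bar> \<le> mat_norm (exterior_power q M)"
        using less less_SucI by (intro M_le image_subsetI) fastforce+
      ultimately show "\<bar>minor (q - 1) f g C\<bar> \<le> mat_norm (exterior_power q M) / \<bar>\<mu>\<bar>"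
        using False by (simp add: field_simps)
    qed (use q in auto)
    thus ?thesis using False by (simp add: field_simps)
  qed
  ultimately show ?thesis by (simp add: denominator_def)
qed

lemma ln_norm_ratio_bounds:
  "ln (mat_norm (exterior_power q M) / denominator q) \<in> {0..ln (1 + 2 * real m * R)}"
proof (cases "denominator q = 0")
  \<comment> \<open>The locale allows the denominator to vanish. Division by 0 gives 0 and
    \<open>ln 0 = 0\<close>, which lies in the interval because \<open>R\<close> is
    nonnegative.\<close>
  case True
  thus ?thesis using norms_nonneg(4) by simp
next
  case False
  hence D: "denominator q > 0" using norms_nonneg(3) by simp
  have "1 \<le> mat_norm (exterior_power q M) / denominator q"
    using D denominator_le_mat_norm by (simp add: field_simps)
  moreover have "mat_norm (exterior_power q M) / denominator q \<le> 1 + 2 * real m * R"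
    using D mat_norm_le_denominator by (simp add: field_simps)
  ultimately show ?thesis by simp
qed

end

end

section \<open>Bounding \<open>phi\<close> along the action\<close>

lemma pick_atLeastLessThan:
  assumes "s < b - a"
  shows "pick {a..<b} s = a + s"
proof -
  have "{x \<in> {a..<b}. x < a + s} = {a..<a + s}" using assms by auto
  thus ?thesis using pick_card_in_set[of "a + s" "{a..<b}"] assms by simp
qed

lemma Phi_eq:
  assumes "X \<in> carrier_mat n n" "1 \<le> i" "j \<le> n"
  shows "Phi i j X = mat (Suc j - i) (Suc j - i) (\<lambda>(s, t). X $$ (i - 1 + s, i - 1 + t))"
proof -
  have "{k. k < n \<and> k \<in> {i - 1..<j}} = {i - 1..<j}" "card {i - 1..<j} = Suc j - i"
    using assms by auto
  thus ?thesis
    using assms by (intro eq_matI) (auto simp: Phi_def submatrix_def pick_atLeastLessThan)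
qed

text \<open>The formula for \<open>rho\<close> is solved for the last column of \<open>Y\<close>: it
  is the corner entry times the image point minus the remaining columns applied to
  \<open>w\<close>.\<close>

lemma bordered_mat_Phi:
  assumes Y: "Y \<in> carrier (UT n)" and i: "1 \<le> i" "i < n" and w: "w \<in> carrier_vec (n - 1)"
    and R: "\<And>k. k < n - 1 \<Longrightarrow> \<bar>w $ k\<bar> \<le> R" "\<And>k. k < n - 1 \<Longrightarrow> \<bar>rho n Y w $ k\<bar> \<le> R"
  shows "bordered_mat (n - i) (Phi i n Y) (Phi i (n - 1) Y) (Y $$ (n - 1, n - 1))
    (\<lambda>s. rho n Y w $ (i - 1 + s)) (\<lambda>s. w $ (i - 1 + s)) R"
proof -
  have Yc: "Y \<in> carrier_mat n n" using Y by (simp add: UT_def)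
  have M: "Phi i n Y = mat (Suc (n - i)) (Suc (n - i)) (\<lambda>(s, t). Y $$ (i - 1 + s, i - 1 + t))"
    using Phi_eq[OF Yc i(1) order_refl] i by (simp add: Suc_diff_le)
  have C: "Phi i (n - 1) Y = mat (n - i) (n - i) (\<lambda>(s, t). Y $$ (i - 1 + s, i - 1 + t))"
    using Phi_eq[OF Yc i(1) diff_le_self] i by simp
  have last: "i - 1 + (n - i) = n - 1" using i by simp
  show ?thesis
  proof (unfold_locales, goal_cases)
    case (4 t)
    hence "i - 1 + t < n - 1" using i by linarith
    hence "Y $$ (n - 1, i - 1 + t) = 0" using Y i by (simp add: UT_carrier_iff)
    thus ?case unfolding M using 4 last by simp
  next
    case 5
    show ?case unfolding M using last by simp
  next
    case (6 s)
    let ?r = "i - 1 + s"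
    have r: "?r < n - 1" using 6 i by simp
    have "Y $$ (n - 1, n - 1) \<noteq> 0" using Y i by (auto simp: UT_carrier_iff)
    hence "Y $$ (?r, n - 1) =
        Y $$ (n - 1, n - 1) * rho n Y w $ ?r - (\<Sum>k<n - 1. Y $$ (?r, k) * w $ k)"
      using rho_index[OF Yc w r] by (simp add: field_simps)
    \<comment> \<open>Columns before \<open>i - 1\<close> meet row \<open>?r\<close> below the
      diagonal, so only columns of the block contribute.\<close>
    also have "(\<Sum>k<n - 1. Y $$ (?r, k) * w $ k) = (\<Sum>k\<in>{i - 1..<n - 1}. Y $$ (?r, k) * w $ k)"
      using Y r by (intro sum.mono_neutral_right) (auto simp: UT_carrier_iff)
    also have "\<dots> = (\<Sum>k<n - i. Y $$ (?r, i - 1 + k) * w $ (i - 1 + k))"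
      by (rule sum.reindex_bij_witness[of _ "\<lambda>k. i - 1 + k" "\<lambda>k. k - (i - 1)"]) (use i in auto)
    also have "\<dots> = (\<Sum>k<n - i. Phi i (n - 1) Y $$ (s, k) * w $ (i - 1 + k))"
      unfolding C using 6 by (intro sum.cong) auto
    finally have "Y $$ (?r, i - 1 + (n - i)) = Y $$ (n - 1, n - 1) * rho n Y w $ ?r -
        (\<Sum>k<n - i. Phi i (n - 1) Y $$ (s, k) * w $ (i - 1 + k))"
      unfolding last .
    moreover have "Phi i n Y $$ (s, n - i) = Y $$ (?r, i - 1 + (n - i))"
      unfolding M using 6 by simp
    ultimately show ?case by argo
  next
    case (7 s)
    thus ?case using i by (intro R) linarith
  next
    case (8 s)
    thus ?case using i by (intro R) linarith
  qed (simp_all add: M C del: One_nat_def)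
qed

lemma phi_component:
  assumes "(i, q, \<epsilon>) \<in> \<Theta>"
  shows "phi n \<Theta> X (i, q, \<epsilon>) =
    ln (mat_norm (exterior_power q (Phi i n (X [^]\<^bsub>UT n\<^esub> \<epsilon>))) /
      max (mat_norm (exterior_power q (Phi i (n - 1) (X [^]\<^bsub>UT n\<^esub> \<epsilon>))))
        (mat_norm (exterior_power (q - 1) (Phi i (n - 1) (X [^]\<^bsub>UT n\<^esub> \<epsilon>))) *
          \<bar>X $$ (n - 1, n - 1) powi \<epsilon>\<bar>))"
  using assms by (simp add: phi_def Let_def)

lemma phi_bounds:
  assumes X: "X \<in> carrier (UT n)" and w: "w \<in> carrier_vec (n - 1)"
    and R: "\<And>k. k < n - 1 \<Longrightarrow> \<bar>w $ k\<bar> \<le> R" "\<And>k. k < n - 1 \<Longrightarrow> \<bar>rho n X w $ k\<bar> \<le> R"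
    and \<theta>: "(i, q, \<epsilon>) \<in> \<Theta>" "(i, q, \<epsilon>) \<in> Theta n"
  shows "phi n \<Theta> X (i, q, \<epsilon>) \<in> {0..ln (1 + 2 * real n * R)}"
proof -
  interpret UT: group "UT n" by (rule group_UT)
  have iq: "1 \<le> i" "i < n" "1 \<le> q" "q \<le> n - i" and \<epsilon>: "\<epsilon> = 1 \<or> \<epsilon> = -1"
    using \<theta>(2) by (auto simp: Theta_def)
  interpret rho: group_action "UT n" "carrier_vec (n - 1)" "rho n"
    using iq by (intro group_action_rho) simp
  define Y where "Y = X [^]\<^bsub>UT n\<^esub> \<epsilon>"
  have Y: "Y \<in> carrier (UT n)" using X by (simp add: Y_def)
  \<comment> \<open>Diagonal entries are multiplicative on triangular matrices, so the inverse
    matrix has the inverse corner entry.\<close>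
  have powi: "X $$ (n - 1, n - 1) powi \<epsilon> = Y $$ (n - 1, n - 1)"
    using \<epsilon>
  proof
    assume "\<epsilon> = -1"
    hence "Y = inv\<^bsub>UT n\<^esub> X" using X by (simp add: Y_def UT.int_pow_neg)
    hence "Y * X = 1\<^sub>m n" using UT.l_inv[OF X] by simp
    hence "X $$ (n - 1, n - 1) * Y $$ (n - 1, n - 1) = 1"
      using UT_mult_diag[OF Y X, of "n - 1"] iq by (simp add: mult.commute)
    hence "inverse (X $$ (n - 1, n - 1)) = Y $$ (n - 1, n - 1)" by (rule inverse_unique)
    thus ?thesis using \<open>\<epsilon> = -1\<close> by simp
  qed (use X in \<open>simp add: Y_def\<close>)
  \<comment> \<open>The starting point for \<open>Y\<close> is \<open>w\<close> if
    \<open>\<epsilon> = 1\<close> and \<open>rho n X w\<close> if \<open>\<epsilon> = -1\<close>.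
    The bound \<open>R\<close> on both endpoints serves either direction.\<close>
  obtain v where v: "v \<in> carrier_vec (n - 1)" "\<And>k. k < n - 1 \<Longrightarrow> \<bar>v $ k\<bar> \<le> R"
    "\<And>k. k < n - 1 \<Longrightarrow> \<bar>rho n Y v $ k\<bar> \<le> R"
    using \<epsilon>
  proof
    assume "\<epsilon> = 1"
    thus ?thesis using that[OF w] X R by (simp add: Y_def)
  next
    assume "\<epsilon> = -1"
    hence "Y = inv\<^bsub>UT n\<^esub> X" using X by (simp add: Y_def UT.int_pow_neg)
    hence "rho n Y (rho n X w) = w" using rho.orbit_sym_aux[OF X w] by simp
    thus ?thesis by (intro that[OF rho_closed[OF w, of X]]) (simp_all add: R)
  qed
  interpret bordered_mat "n - i" "Phi i n Y" "Phi i (n - 1) Y" "Y $$ (n - 1, n - 1)"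
    "\<lambda>s. rho n Y v $ (i - 1 + s)" "\<lambda>s. v $ (i - 1 + s)" R
    by (rule bordered_mat_Phi[OF Y iq(1,2) v])
  have "phi n \<Theta> X (i, q, \<epsilon>) \<in> {0..ln (1 + 2 * real (n - i) * R)}"
    using ln_norm_ratio_bounds[OF iq(3,4)]
    unfolding phi_component[OF \<theta>(1)] Y_def[symmetric] powi denominator_def .
  \<comment> \<open>Enlarging \<open>n - i\<close> to \<open>n\<close> gives one interval for all
    components of \<open>phi\<close>.\<close>
  moreover have "ln (1 + 2 * real (n - i) * R) \<le> ln (1 + 2 * real n * R)"
    using norms_nonneg(4)[OF iq(3,4)] 
    by (intro ln_mono add_mono mult_right_mono) (simp_all add: add_pos_nonneg)
  ultimately show ?thesis by auto
qed

section \<open>Properness of the action\<close>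

lemma compactin_vec_topology_bounded:
  assumes K: "compactin (vec_topology m) K"
  obtains R where "\<And>w k. w \<in> K \<Longrightarrow> k < m \<Longrightarrow> \<bar>w $ k\<bar> \<le> R"
proof -
  have "\<exists>r. \<forall>w\<in>K. \<bar>w $ k\<bar> \<le> r" if "k < m" for k
    using image_compactin[OF K continuous_map_vec_entry[OF that]]
    by (auto dest!: compact_imp_bounded simp: bounded_iff)
  then obtain r where r: "\<And>k w. k < m \<Longrightarrow> w \<in> K \<Longrightarrow> \<bar>w $ k\<bar> \<le> r k" by metis
  have "\<bar>w $ k\<bar> \<le> Max (r ` {..<m})" if "w \<in> K" "k < m" for w k
    using r[OF that(2,1)] that(2) by (intro order_trans[OF _ Max_ge]) auto
  thus ?thesis using that by blast
qed

lemma continuous_action_subgroup: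
  assumes act: "continuous_action G TG S \<alpha>" and H: "subgroup H G"
  shows "continuous_action (G\<lparr>carrier := H\<rparr>) (subtopology TG H) S \<alpha>"
proof -
  have top: "topspace TG = carrier G" and act': "group_action G (topspace S) \<alpha>"
    and cont: "continuous_map (prod_topology TG S) S (\<lambda>(g, x). \<alpha> g x)"
    using act by (auto simp: continuous_action_def)
  have "topspace (subtopology TG H) = H" using subgroup.subset[OF H] top by auto
  thus ?thesis
    unfolding continuous_action_def prod_topology_subtopology
    using group_action.induced_action[OF act' H] continuous_map_from_subtopology[OF cont] by simp
qed

text \<open>The preimage of \<open>K\<close> is closed, since compact sets in a Hausdorff space are
  closed, and lies in \<open>C\<close> times the first projection of \<open>K\<close>. Hence it is
  enough to confine the group elements to a compact set.\<close>

lemma compact_preimages_action: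
  assumes act: "continuous_action G TG S \<alpha>" and H: "Hausdorff_space S"
    and cpt: "\<And>A B. compactin S A \<Longrightarrow> compactin S B \<Longrightarrow>
      \<exists>C. compactin TG C \<and> {g \<in> topspace TG. \<exists>x\<in>A. \<alpha> g x \<in> B} \<subseteq> C"
  shows "compact_preimages (prod_topology TG S) (prod_topology S S) (\<lambda>(g, x). (x, \<alpha> g x))"
  unfolding compact_preimages_def
proof (intro allI impI)
  fix K assume K: "compactin (prod_topology S S) K"
  let ?P = "prod_topology TG S"
  have A: "compactin S (fst ` K)" "compactin S (snd ` K)"
    by (rule image_compactin[OF K continuous_map_fst], rule image_compactin[OF K continuous_map_snd])
  then obtain C where C: "compactin TG C"
    "{g \<in> topspace TG. \<exists>x\<in>fst ` K. \<alpha> g x \<in> snd ` K} \<subseteq> C"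
    using cpt by blast
  have "continuous_map ?P S (\<lambda>(g, x). \<alpha> g x)"
    using act by (simp add: continuous_action_def)
  hence "continuous_map ?P (prod_topology S S) (\<lambda>p. (snd p, (\<lambda>(g, x). \<alpha> g x) p))"
    by (intro continuous_map_pairedI continuous_map_snd)
  hence "continuous_map ?P (prod_topology S S) (\<lambda>(g, x). (x, \<alpha> g x))"
    by (simp add: case_prod_unfold)
  moreover have "closedin (prod_topology S S) K"
    using H by (intro compactin_imp_closedin K) (simp add: Hausdorff_space_prod_topology)
  ultimately have "closedin ?P {p \<in> topspace ?P. (\<lambda>(g, x). (x, \<alpha> g x)) p \<in> K}"
    by (rule closedin_continuous_map_preimage)
  moreover have "compactin ?P (C \<times> fst ` K)"
    using C A by (simp add: compactin_Times)
  moreover have "{p \<in> topspace ?P. (\<lambda>(g, x). (x, \<alpha> g x)) p \<in> K} \<subseteq> C \<times> fst ` K"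
    using C(2) by force
  ultimately show "compactin ?P {p \<in> topspace ?P. (\<lambda>(g, x). (x, \<alpha> g x)) p \<in> K}"
    using closed_compactin by blast
qed

theorem theorem2:
  fixes n :: nat and L :: "real mat set" and \<Theta> :: "(nat \<times> nat \<times> int) set"
  assumes "n \<ge> 2"
    and "subgroup L (UT n)"
    and "closedin (UT_topology n) L"
    and "\<Theta> \<noteq> {}"
    and "\<Theta> \<subseteq> Theta n"
    and "compact_preimages (subtopology (UT_topology n) L) (powertop_real \<Theta>) (phi n \<Theta>)"
  shows "proper_action ((UT n)\<lparr>carrier := L\<rparr>) (subtopology (UT_topology n) L)
           (vec_topology (n - 1)) (rho n)"
proof -
  let ?S = "vec_topology (n - 1)" and ?TL = "subtopology (UT_topology n) L"
  have L: "L \<subseteq> carrier (UT n)" using assms(2) by (rule subgroup.subset)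
  have act: "continuous_action ((UT n)\<lparr>carrier := L\<rparr>) ?TL ?S (rho n)"
    using assms(1,2) by (intro continuous_action_subgroup continuous_action_rho) auto
  moreover have "compact_preimages (prod_topology ?TL ?S) (prod_topology ?S ?S)
      (\<lambda>(X, w). (w, rho n X w))"
  proof (rule compact_preimages_action[OF act lch_vec_topology(2)])
    fix A B assume A: "compactin ?S A" and B: "compactin ?S B"
    \<comment> \<open>Passing to the union gives a single \<open>R\<close> for the points and their
      images.\<close>
    from A B have "compactin ?S (A \<union> B)" by (rule compactin_Un)
    from compactin_vec_topology_bounded[OF this] obtain R
      where R: "\<And>w k. w \<in> A \<union> B \<Longrightarrow> k < n - 1 \<Longrightarrow> \<bar>w $ k\<bar> \<le> R" by blast
    \<comment> \<open>A product of compact intervals, hence compact; properness of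
      \<open>phi\<close> on \<open>L\<close> turns it into the required compact set of group
      elements.\<close>
    let ?box = "PiE \<Theta> (\<lambda>_. {0..ln (1 + 2 * real n * R)})"
    have "compactin (powertop_real \<Theta>) ?box" by (simp add: compactin_PiE)
    hence "compactin ?TL {X \<in> topspace ?TL. phi n \<Theta> X \<in> ?box}"
      using assms(6) unfolding compact_preimages_def by blast
    moreover have "phi n \<Theta> X \<in> ?box"
      if X: "X \<in> topspace ?TL" and w: "w \<in> A" "rho n X w \<in> B" for X w
    proof (rule PiE_I)
      fix \<theta> assume \<theta>: "\<theta> \<in> \<Theta>"
      obtain i q \<epsilon> where eq: "\<theta> = (i, q, \<epsilon>)" by (cases \<theta>)
      have "X \<in> carrier (UT n)" "w \<in> carrier_vec (n - 1)"
        using X w compactin_subset_topspace[OF A] by auto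
      moreover have "\<And>k. k < n - 1 \<Longrightarrow> \<bar>w $ k\<bar> \<le> R" "\<And>k. k < n - 1 \<Longrightarrow> \<bar>rho n X w $ k\<bar> \<le> R"
        using R w by blast+
      moreover have "(i, q, \<epsilon>) \<in> \<Theta>" "(i, q, \<epsilon>) \<in> Theta n"
        using \<theta> assms(5) unfolding eq by blast+
      ultimately show "phi n \<Theta> X \<theta> \<in> {0..ln (1 + 2 * real n * R)}"
        unfolding eq by (rule phi_bounds)
    qed (simp add: phi_def)
    ultimately show "\<exists>C. compactin ?TL C \<and> {X \<in> topspace ?TL. \<exists>w\<in>A. rho n X w \<in> B} \<subseteq> C"
      by blast
  qed
  ultimately show ?thesis unfolding proper_action_def ..
qed

end
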